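(* Let $(M,\Delta)$ be a strict homogeneous structure and let $n\in\mathbb{R}$. Then: (i) $P\in A^k(M)$ is $\Delta$-homogeneous of degree $n$ if and only if $\{f_1,\dots,f_k\}_P$ is $\Delta$-homogeneous of degree $n+k$ for all $f_1,\dots,f_k\in S^1_\Delta(M)$. (ii) $D\in D^k(M)$ is $\Delta$-homogeneous of degree $n$ if and only if $\{f_1,\dots,f_k\}_D$ is $\Delta$-homogeneous of degree $n+\deg(f_1)+\dots+\deg(f_k)$ for all $\Delta$-homogeneous functions $f_1,\dots,f_k$ of degree $1$ or $0$.
   Context: All objects are smooth. A homogeneous structure is a pair $(M,\Delta)$ of a manifold and a vector field on it. $f\in C^\infty(M)$ is $\Delta$-homogeneous of degree $n$ ($\deg f=n$) if $\Delta(f)=nf$; $S^n_\Delta(M)$ is the space of such functions. $(M,\Delta)$ is strict if there is an open dense subset $O\subset M$ such that $T^*_xM=\{df(x):f\in S^1_\Delta(M)\}$ for all $x\in O$. $A^k(M)=\mathrm{Sec}(\wedge^kTM)$; $T^1M=TM\oplus\mathbb{R}$ is the bundle of first-order differential operators on $C^\infty(M)$, $I_M=0\oplus1_M\in\mathrm{Sec}(T^1M)$, and $D^k(M)=\mathrm{Sec}(\wedge^kT^1M)$. Each $D\in D^k(M)$ is uniquely $D=D^0+I_M\wedge D^1$ with $D^0\in A^k(M)$, $D^1\in A^{k-1}(M)$. $P\in A^k(M)$ is $\Delta$-homogeneous of degree $n$ if $\mathcal{L}_\Delta P=nP$. $D\in D^k(M)$ is $\Delta$-homogeneous of degree $n$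 if $[\![\Delta,D]\!]^1_M=nD$, where $[\![\cdot,\cdot]\!]^1_M$ is the Schouten-Jacobi bracket, for which $[\![\Delta,D^0+I_M\wedge D^1]\!]^1_M=\mathcal{L}_\Delta D^0+I_M\wedge\mathcal{L}_\Delta D^1$; equivalently, $D^0$ and $D^1$ are both $\Delta$-homogeneous of degree $n$. Brackets of functions: $\{f_1,\dots,f_k\}_P=\langle P,df_1\wedge\dots\wedge df_k\rangle$ for $P\in A^k(M)$, and $\{f_1,\dots,f_k\}_D=\{f_1,\dots,f_k\}_{D^0}+\sum_{i=1}^k(-1)^{i+1}f_i\{f_1,\dots,\widehat{f_i},\dots,f_k\}_{D^1}$ for $D=D^0+I_M\wedge D^1\in D^k(M)$. *)

theory Defs
  imports "HOL-Analysis.Analysis"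
begin

section \<open>Smooth maps between Euclidean spaces\<close>

text \<open>
  The derivative is taken within S because S will be a relatively open subset of a coordinate
  subspace of the Euclidean space. If that subspace is proper, the derivative is not unique in the
  transversal directions; the existential quantifier then amounts to the usual notion of a C^k map
  on an open subset of the subspace.
\<close>

fun Ck_on :: "nat \<Rightarrow> ('a::real_normed_vector \<Rightarrow> 'b::real_normed_vector) \<Rightarrow> 'a set \<Rightarrow> bool" where
  "Ck_on 0 f S \<longleftrightarrow> continuous_on S f"
| "Ck_on (Suc k) f S \<longleftrightarrow>
     (\<exists>f'. (\<forall>x\<in>S. (f has_derivative f' x) (at x within S)) \<and> (\<forall>v. Ck_on k (\<lambda>x. f' x v) S))"

definition smooth_on :: "('a::real_normed_vector \<Rightarrow> 'b::real_normed_vector) \<Rightarrow> 'a set \<Rightarrow> bool" where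
  "smooth_on f S \<longleftrightarrow> (\<forall>k. Ck_on k f S)"

section \<open>Manifolds and smooth functions\<close>

type_synonym ('m, 'e) chart = "'m set \<times> ('m \<Rightarrow> 'e)"
type_synonym ('m, 'e) atlas = "('m, 'e) chart set"

text \<open>
  The manifold is the type 'm; the model space is the span of a set B of standard basis vectors,
  that is, R^n with n = card B. (Taking B empty gives the 0-dimensional manifolds, which the class
  of Euclidean spaces by itself would exclude.)
\<close>

definition smooth_manifold ::
    "'e::euclidean_space set \<Rightarrow> ('m::{t2_space,second_countable_topology}, 'e) atlas \<Rightarrow> bool" where
  "smooth_manifold B A \<longleftrightarrow>
     B \<subseteq> Basis \<and>
     (\<Union>(U, \<phi>)\<in>A. U) = UNIV \<and>
     (\<forall>(U, \<phi>)\<in>A. open U \<and> openin (top_of_set (span B)) (\<phi> ` U) \<and>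
        homeomorphism U (\<phi> ` U) \<phi> (inv_into U \<phi>)) \<and>
     (\<forall>(U, \<phi>)\<in>A. \<forall>(V, \<psi>)\<in>A. smooth_on (\<psi> \<circ> inv_into U \<phi>) (\<phi> ` (U \<inter> V)))"

text \<open>Smoothness of (the restriction of) a function on an open set W.\<close>

definition smooth_fun ::
    "('m::topological_space, 'e::euclidean_space) atlas \<Rightarrow> 'm set \<Rightarrow> ('m \<Rightarrow> real) \<Rightarrow> bool" where
  "smooth_fun A W f \<longleftrightarrow> (\<forall>(U, \<phi>)\<in>A. smooth_on (f \<circ> inv_into U \<phi>) (\<phi> ` (U \<inter> W)))"

definition smooth_near ::
    "('m::topological_space, 'e::euclidean_space) atlas \<Rightarrow> 'm \<Rightarrow> ('m \<Rightarrow> real) set" where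
  "smooth_near A x = {f. \<exists>W. open W \<and> x \<in> W \<and> smooth_fun A W f}"

section \<open>Tangent and cotangent spaces\<close>

text \<open>
  Tangent vectors are derivations at x of the functions that are smooth near x. Such a derivation
  depends only on the germ of its argument: multiply by the indicator function of a neighbourhood
  of x, which is smooth near x. All functionals are extended by 0 outside their domain, so that
  equality of functions is equality of functionals.
\<close>

type_synonym 'm tangent = "('m \<Rightarrow> real) \<Rightarrow> real"
type_synonym 'm cotangent = "'m tangent \<Rightarrow> real"

definition tangent_space ::
    "('m::topological_space, 'e::euclidean_space) atlas \<Rightarrow> 'm \<Rightarrow> 'm tangent set" where
  "tangent_space A x =
     {v. (\<forall>f\<in>smooth_near A x. \<forall>g\<in>smooth_near A x. \<forall>c d.
            v (\<lambda>y. c * f y + d * g y) = c * v f + d * v g) \<and>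
         (\<forall>f\<in>smooth_near A x. \<forall>g\<in>smooth_near A x.
            v (\<lambda>y. f y * g y) = f x * v g + g x * v f) \<and>
         (\<forall>f. f \<notin> smooth_near A x \<longrightarrow> v f = 0)}"

definition cotangent_space ::
    "('m::topological_space, 'e::euclidean_space) atlas \<Rightarrow> 'm \<Rightarrow> 'm cotangent set" where
  "cotangent_space A x =
     {a. (\<forall>u\<in>tangent_space A x. \<forall>v\<in>tangent_space A x. \<forall>c d.
            a (\<lambda>f. c * u f + d * v f) = c * a u + d * a v) \<and>
         (\<forall>v. v \<notin> tangent_space A x \<longrightarrow> a v = 0)}"

definition differential ::
    "('m::topological_space, 'e::euclidean_space) atlas \<Rightarrow> ('m \<Rightarrow> real) \<Rightarrow> 'm \<Rightarrow> 'm cotangent" where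
  "differential A f x = (\<lambda>v. if v \<in> tangent_space A x then v f else 0)"

section \<open>Vector fields and one-forms on open sets\<close>

definition vector_field ::
    "('m::topological_space, 'e::euclidean_space) atlas \<Rightarrow> 'm set \<Rightarrow> ('m \<Rightarrow> 'm tangent) \<Rightarrow> bool" where
  "vector_field A W X \<longleftrightarrow>
     (\<forall>x\<in>W. X x \<in> tangent_space A x) \<and>
     (\<forall>(U, \<phi>)\<in>A. \<forall>b\<in>Basis. smooth_fun A (U \<inter> W) (\<lambda>x. X x (\<lambda>y. \<phi> y \<bullet> b)))"

definition one_form ::
    "('m::topological_space, 'e::euclidean_space) atlas \<Rightarrow> 'm set \<Rightarrow> ('m \<Rightarrow> 'm cotangent) \<Rightarrow> bool" where
  "one_form A W \<alpha> \<longleftrightarrow>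
     (\<forall>x\<in>W. \<alpha> x \<in> cotangent_space A x) \<and>
     (\<forall>V X. open V \<and> V \<subseteq> W \<and> vector_field A V X \<longrightarrow> smooth_fun A V (\<lambda>x. \<alpha> x (X x)))"

section \<open>Multivector fields and sections of the exterior powers of TM + R\<close>

text \<open>
  The k-th exterior power of a finite-dimensional real vector space V is taken to be the space of
  alternating k-linear forms on the dual W of V, a decomposable element acting by
  (v_1 \<and> ... \<and> v_k)(w_1, ..., w_k) = det (w_i(v_j)). The pairing of P with
  w_1 \<and> ... \<and> w_k is then the value P [w_1, ..., w_k]. The argument lc of the following
  definition is the linear combination on W: lc c a d b stands for c a + d b.
\<close>

definition alternating_forms ::
    "nat \<Rightarrow> 'w set \<Rightarrow> (real \<Rightarrow> 'w \<Rightarrow> real \<Rightarrow> 'w \<Rightarrow> 'w) \<Rightarrow> ('w list \<Rightarrow> real) set" where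
  "alternating_forms k W lc =
     {F. (\<forall>ws i a b c d. length ws = k \<and> set ws \<subseteq> W \<and> i < k \<and> a \<in> W \<and> b \<in> W \<longrightarrow>
            F (ws[i := lc c a d b]) = c * F (ws[i := a]) + d * F (ws[i := b])) \<and>
         (\<forall>ws i j. length ws = k \<and> set ws \<subseteq> W \<and> i < j \<and> j < k \<and> ws ! i = ws ! j \<longrightarrow> F ws = 0) \<and>
         (\<forall>ws. \<not> (length ws = k \<and> set ws \<subseteq> W) \<longrightarrow> F ws = 0)}"

definition cotangent_lc ::
    "real \<Rightarrow> 'm cotangent \<Rightarrow> real \<Rightarrow> 'm cotangent \<Rightarrow> 'm cotangent" where
  "cotangent_lc c a d b = (\<lambda>v. c * a v + d * b v)"

type_synonym 'm multivector = "'m cotangent list \<Rightarrow> real"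

definition multivector_fields ::
    "('m::topological_space, 'e::euclidean_space) atlas \<Rightarrow> nat \<Rightarrow> ('m \<Rightarrow> 'm multivector) set" where
  "multivector_fields A k =
     {P. (\<forall>x. P x \<in> alternating_forms k (cotangent_space A x) cotangent_lc) \<and>
         (\<forall>(U, \<phi>)\<in>A. \<forall>bs. length bs = k \<and> set bs \<subseteq> Basis \<longrightarrow>
            smooth_fun A U (\<lambda>x. P x (map (\<lambda>b. differential A (\<lambda>y. \<phi> y \<bullet> b) x) bs)))}"

text \<open>
  The fibre of the dual of T^1 M = TM + R at x is T*_x M + R; the pair (a, t) evaluates to
  a(v) + t s on the operator v + s I_M. The first jet of f at x is (df(x), f(x)).
\<close>

type_synonym 'm cojet = "'m cotangent \<times> real"
type_synonym 'm jet_multivector = "'m cojet list \<Rightarrow> real"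

definition cojet_space ::
    "('m::topological_space, 'e::euclidean_space) atlas \<Rightarrow> 'm \<Rightarrow> 'm cojet set" where
  "cojet_space A x = cotangent_space A x \<times> UNIV"

definition cojet_lc :: "real \<Rightarrow> 'm cojet \<Rightarrow> real \<Rightarrow> 'm cojet \<Rightarrow> 'm cojet" where
  "cojet_lc c p d q = (cotangent_lc c (fst p) d (fst q), c * snd p + d * snd q)"

text \<open>
  Smoothness is tested on the coframe of the dual bundle given by the coordinate differentials
  (Some b) and the covector (0, 1) dual to I_M (None).
\<close>

definition jet_coframe ::
    "('m::topological_space, 'e::euclidean_space) atlas \<Rightarrow> ('m \<Rightarrow> 'e) \<Rightarrow> 'm \<Rightarrow> 'e option \<Rightarrow> 'm cojet" where
  "jet_coframe A \<phi> x ob =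
     (case ob of None \<Rightarrow> (\<lambda>v. 0, 1) | Some b \<Rightarrow> (differential A (\<lambda>y. \<phi> y \<bullet> b) x, 0))"

definition jet_multivector_fields ::
    "('m::topological_space, 'e::euclidean_space) atlas \<Rightarrow> nat \<Rightarrow> ('m \<Rightarrow> 'm jet_multivector) set" where
  "jet_multivector_fields A k =
     {D. (\<forall>x. D x \<in> alternating_forms k (cojet_space A x) cojet_lc) \<and>
         (\<forall>(U, \<phi>)\<in>A. \<forall>bs. length bs = k \<and> set bs \<subseteq> insert None (Some ` Basis) \<longrightarrow>
            smooth_fun A U (\<lambda>x. D x (map (jet_coframe A \<phi> x) bs)))}"

text \<open>
  The components of D = D^0 + I_M \<and> D^1. They are recovered by evaluating D on covectors (a, 0)
  and by contracting D in its first slot with (0, 1), since (0, 1) kills D^0 and pairs to 1 with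
  I_M. For k = 0 the second component is zero.
\<close>

definition part0 :: "('m \<Rightarrow> 'm jet_multivector) \<Rightarrow> 'm \<Rightarrow> 'm multivector" where
  "part0 D x as = D x (map (\<lambda>a. (a, 0)) as)"

definition part1 :: "('m \<Rightarrow> 'm jet_multivector) \<Rightarrow> 'm \<Rightarrow> 'm multivector" where
  "part1 D x as = D x ((\<lambda>v. 0, 1) # map (\<lambda>a. (a, 0)) as)"

definition remove_nth :: "nat \<Rightarrow> 'a list \<Rightarrow> 'a list" where
  "remove_nth i xs = take i xs @ drop (Suc i) xs"

text \<open>The section P + I_M \<and> Q of the k-th exterior power, for P in A^k(M) and Q in A^(k-1)(M).\<close>

definition join_parts ::
    "('m::topological_space, 'e::euclidean_space) atlas \<Rightarrow> nat \<Rightarrow>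
       ('m \<Rightarrow> 'm multivector) \<Rightarrow> ('m \<Rightarrow> 'm multivector) \<Rightarrow> 'm \<Rightarrow> 'm jet_multivector" where
  "join_parts A k P Q x ws =
     (if length ws = k \<and> set ws \<subseteq> cojet_space A x
      then P x (map fst ws) + (\<Sum>i<k. (-1) ^ i * snd (ws ! i) * Q x (map fst (remove_nth i ws)))
      else 0)"

section \<open>Lie derivatives\<close>

definition lie_bracket ::
    "('m::topological_space, 'e::euclidean_space) atlas \<Rightarrow>
       ('m \<Rightarrow> 'm tangent) \<Rightarrow> ('m \<Rightarrow> 'm tangent) \<Rightarrow> 'm \<Rightarrow> 'm tangent" where
  "lie_bracket A X Y x =
     (\<lambda>f. if f \<in> smooth_near A x then X x (\<lambda>y. Y y f) - Y x (\<lambda>y. X y f) else 0)"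

text \<open>
  The Lie derivative along Z is Z on functions and [Z, _] on vector fields, and it is extended to
  one-forms and multivector fields by the Leibniz rule for contractions:
    (L_Z a)(X) = Z(a(X)) - a([Z, X]),
    (L_Z P)(a_1, ..., a_k) = Z(P(a_1, ..., a_k)) - sum_i P(a_1, ..., L_Z a_i, ..., a_k).
  The right-hand sides are tensorial, so that the value at x depends only on the values at x of the
  arguments; the definite descriptions below range over all smooth extensions of these values to a
  neighbourhood of x.
\<close>

definition lie_one_form ::
    "('m::topological_space, 'e::euclidean_space) atlas \<Rightarrow>
       ('m \<Rightarrow> 'm tangent) \<Rightarrow> ('m \<Rightarrow> 'm cotangent) \<Rightarrow> 'm \<Rightarrow> 'm cotangent" where
  "lie_one_form A Z \<alpha> x v =
     (if v \<in> tangent_space A x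
      then THE r. \<forall>W X. open W \<and> x \<in> W \<and> vector_field A W X \<and> X x = v \<longrightarrow>
             r = Z x (\<lambda>y. \<alpha> y (X y)) - \<alpha> x (lie_bracket A Z X x)
      else 0)"

definition lie_multivector ::
    "('m::topological_space, 'e::euclidean_space) atlas \<Rightarrow>
       ('m \<Rightarrow> 'm tangent) \<Rightarrow> nat \<Rightarrow> ('m \<Rightarrow> 'm multivector) \<Rightarrow> 'm \<Rightarrow> 'm multivector" where
  "lie_multivector A Z k P x as =
     (if length as = k \<and> set as \<subseteq> cotangent_space A x
      then THE r. \<forall>W \<alpha>s. open W \<and> x \<in> W \<and> (\<forall>\<alpha>\<in>set \<alpha>s. one_form A W \<alpha>) \<and> map (\<lambda>\<alpha>. \<alpha> x) \<alpha>s = as \<longrightarrow>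
             r = Z x (\<lambda>y. P y (map (\<lambda>\<alpha>. \<alpha> y) \<alpha>s))
                 - (\<Sum>i<k. P x (as[i := lie_one_form A Z (\<alpha>s ! i) x]))
      else 0)"

text \<open>
  The Schouten-Jacobi bracket of a vector field Z with D = D^0 + I_M \<and> D^1, which is
  L_Z D^0 + I_M \<and> L_Z D^1. (For k = 0 the component D^1 is zero, and the truncated
  k - 1 is harmless.)
\<close>

definition schouten_jacobi ::
    "('m::topological_space, 'e::euclidean_space) atlas \<Rightarrow>
       ('m \<Rightarrow> 'm tangent) \<Rightarrow> nat \<Rightarrow> ('m \<Rightarrow> 'm jet_multivector) \<Rightarrow> 'm \<Rightarrow> 'm jet_multivector" where
  "schouten_jacobi A Z k D =
     join_parts A k (lie_multivector A Z k (part0 D)) (lie_multivector A Z (k - 1) (part1 D))"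

section \<open>Homogeneity\<close>

definition homogeneous_functions ::
    "('m::topological_space, 'e::euclidean_space) atlas \<Rightarrow> ('m \<Rightarrow> 'm tangent) \<Rightarrow> real \<Rightarrow> ('m \<Rightarrow> real) set" where
  "homogeneous_functions A \<Delta> n = {f. smooth_fun A UNIV f \<and> (\<forall>x. \<Delta> x f = n * f x)}"

definition homogeneous_multivector ::
    "('m::topological_space, 'e::euclidean_space) atlas \<Rightarrow>
       ('m \<Rightarrow> 'm tangent) \<Rightarrow> nat \<Rightarrow> real \<Rightarrow> ('m \<Rightarrow> 'm multivector) \<Rightarrow> bool" where
  "homogeneous_multivector A \<Delta> k n P \<longleftrightarrow> lie_multivector A \<Delta> k P = (\<lambda>x as. n * P x as)"

definition homogeneous_jet_multivector ::
    "('m::topological_space, 'e::euclidean_space) atlas \<Rightarrow>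
       ('m \<Rightarrow> 'm tangent) \<Rightarrow> nat \<Rightarrow> real \<Rightarrow> ('m \<Rightarrow> 'm jet_multivector) \<Rightarrow> bool" where
  "homogeneous_jet_multivector A \<Delta> k n D \<longleftrightarrow> schouten_jacobi A \<Delta> k D = (\<lambda>x ws. n * D x ws)"

definition homogeneous_structure ::
    "'e::euclidean_space set \<Rightarrow> ('m::{t2_space,second_countable_topology}, 'e) atlas \<Rightarrow>
       ('m \<Rightarrow> 'm tangent) \<Rightarrow> bool" where
  "homogeneous_structure B A \<Delta> \<longleftrightarrow> smooth_manifold B A \<and> vector_field A UNIV \<Delta>"

definition strict_homogeneous_structure ::
    "'e::euclidean_space set \<Rightarrow> ('m::{t2_space,second_countable_topology}, 'e) atlas \<Rightarrow>
       ('m \<Rightarrow> 'm tangent) \<Rightarrow> bool" where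
  "strict_homogeneous_structure B A \<Delta> \<longleftrightarrow>
     homogeneous_structure B A \<Delta> \<and>
     (\<exists>S. open S \<and> closure S = UNIV \<and>
        (\<forall>x\<in>S. cotangent_space A x = {differential A f x | f. f \<in> homogeneous_functions A \<Delta> 1}))"

section \<open>Brackets of functions\<close>

definition bracket ::
    "('m::topological_space, 'e::euclidean_space) atlas \<Rightarrow>
       ('m \<Rightarrow> 'm multivector) \<Rightarrow> ('m \<Rightarrow> real) list \<Rightarrow> 'm \<Rightarrow> real" where
  "bracket A P fs x = P x (map (\<lambda>f. differential A f x) fs)"

definition jet_bracket ::
    "('m::topological_space, 'e::euclidean_space) atlas \<Rightarrow>
       ('m \<Rightarrow> 'm jet_multivector) \<Rightarrow> ('m \<Rightarrow> real) list \<Rightarrow> 'm \<Rightarrow> real" where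
  "jet_bracket A D fs x =
     bracket A (part0 D) fs x +
     (\<Sum>i<length fs. (-1) ^ i * (fs ! i) x * bracket A (part1 D) (remove_nth i fs) x)"

end

theory Submission
  imports Defs
begin

text \<open>
  Let L denote the Lie derivative along \<Delta>. For functions f_1, ..., f_k with \<Delta> f_i = d_i f_i one
  has L (df_i) = d_i df_i, so that the Leibniz rule that defines L P reads
    (L P)(df_1, ..., df_k) = \<Delta> {f_1, ..., f_k} - (d_1 + ... + d_k) {f_1, ..., f_k}
  (\<open>lie_multivector_differentials\<close>). If L P = n P, the bracket therefore has degree
  n + d_1 + ... + d_k. Conversely, if the brackets of functions of degree 1 have degree n + k, then
  L P - n P vanishes on all lists of covectors of the form df(x) with f of degree 1. By strictness
  these are all covectors at the points of a dense open set; the components of L P - n P in a chart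
  are smooth, hence continuous, and vanish on a dense set, hence everywhere
  (\<open>homogeneous_multivectorI\<close>).

  For D = D^0 + I_M \<and> D^1 the constant function 1 has degree 0 and zero differential, whence
  {1, f_2, ..., f_k}_D = {f_2, ..., f_k}_{D^1} (\<open>jet_bracket_one\<close>). So the brackets of D determine
  those of D^1, and then those of D^0 by subtraction, and the case of multivector fields applies to
  both components. That homogeneity of D is homogeneity of D^0 and D^1 rests on the fact that D is
  recovered from its two components (\<open>jet_decomposition\<close>).

  What makes these computations legitimate is that the Lie derivatives, which are specified by
  definite descriptions over all local extensions, exist and are tensorial. Every derivation v at x
  is the combination of the coordinate vectors with coefficients v(\<phi>_b) (\<open>tangent_expand\<close>, a
  consequence of Hadamard's lemma), and dually for covectors. Expanding one argument at a time in
  the coordinate frame, the derivatives of the coefficients cancel in the defining expressions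
  (\<open>lie_one_form_tensorial\<close> and \<open>leibniz_defect_expand\<close>), and only the values at x remain. All
  expansions run over the whole of Basis: for b outside B both the coordinate vector and the
  coordinate differential are zero.
\<close>

section \<open>Smooth maps on subsets of Euclidean space\<close>

lemma Ck_on_SucE:
  assumes "Ck_on (Suc k) f S"
  obtains f' where "\<And>x. x \<in> S \<Longrightarrow> (f has_derivative f' x) (at x within S)"
    "\<And>v. Ck_on k (\<lambda>x. f' x v) S"
  using assms by auto

lemma Ck_on_subset:
  assumes "Ck_on k f S" "T \<subseteq> S"
  shows "Ck_on k f T"
  using assms
proof (induction k arbitrary: f)
  case 0
  then show ?case by (auto intro: continuous_on_subset)
next
  case (Suc k)
  then obtain f' where f': "\<And>x. x \<in> S \<Longrightarrow> (f has_derivative f' x) (at x within S)"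
    "\<And>v. Ck_on k (\<lambda>x. f' x v) S" by auto
  have "\<forall>x\<in>T. (f has_derivative f' x) (at x within T)"
    using f'(1) Suc.prems(2) by (meson has_derivative_subset subsetD)
  moreover have "\<forall>v. Ck_on k (\<lambda>x. f' x v) T" using f'(2) Suc.IH Suc.prems(2) by blast
  ultimately show ?case by auto
qed

lemma Ck_on_cong_imp:
  assumes "Ck_on k f S" "\<And>x. x \<in> S \<Longrightarrow> f x = g x"
  shows "Ck_on k g S"
proof (cases k)
  case 0
  then show ?thesis using assms continuous_on_cong by (metis Ck_on.simps(1))
next
  case (Suc j)
  then obtain f' where f': "\<And>x. x \<in> S \<Longrightarrow> (f has_derivative f' x) (at x within S)"
    "\<And>v. Ck_on j (\<lambda>x. f' x v) S" using assms by auto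
  have "\<forall>x\<in>S. (g has_derivative f' x) (at x within S)"
    using f'(1) assms(2) by (metis has_derivative_transform)
  then show ?thesis using f'(2) Suc by auto
qed

lemma Ck_on_Suc_imp: "Ck_on (Suc k) f S \<Longrightarrow> Ck_on k f S"
proof (induction k arbitrary: f)
  case 0
  then show ?case by (auto simp: continuous_on_eq_continuous_within intro: has_derivative_continuous)
next
  case (Suc k)
  from Suc.prems obtain f' where f': "\<And>x. x \<in> S \<Longrightarrow> (f has_derivative f' x) (at x within S)"
    "\<And>v. Ck_on (Suc k) (\<lambda>x. f' x v) S" by (elim Ck_on_SucE) blast
  show ?case unfolding Ck_on.simps
    using f'(1) Suc.IH[OF f'(2)] by (intro exI[of _ f']) blast
qed

lemma Ck_on_const: "Ck_on k (\<lambda>x. c) S"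
proof (induction k arbitrary: c)
  case (Suc k)
  then show ?case by (auto intro!: exI[of _ "\<lambda>x v. 0"])
qed simp

lemma Ck_on_bounded_linear:
  assumes "bounded_linear h"
  shows "Ck_on k h S"
proof (cases k)
  case 0
  then show ?thesis using assms linear_continuous_on by auto
next
  case (Suc j)
  have "\<forall>x\<in>S. (h has_derivative h) (at x within S)"
    using assms bounded_linear_imp_has_derivative by blast
  then show ?thesis unfolding Suc Ck_on.simps using Ck_on_const
    by (intro exI[of _ "\<lambda>x. h"]) auto
qed

lemma Ck_on_add:
  assumes "Ck_on k f S" "Ck_on k g S"
  shows "Ck_on k (\<lambda>x. f x + g x) S"
  using assms
proof (induction k arbitrary: f g)
  case 0
  then show ?case by (auto intro: continuous_intros)
next
  case (Suc k)
  from Suc.prems(1) obtain f' where f': "\<And>x. x \<in> S \<Longrightarrow> (f has_derivative f' x) (at x within S)"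
    "\<And>v. Ck_on k (\<lambda>x. f' x v) S" by (elim Ck_on_SucE) blast
  from Suc.prems(2) obtain g' where g': "\<And>x. x \<in> S \<Longrightarrow> (g has_derivative g' x) (at x within S)"
    "\<And>v. Ck_on k (\<lambda>x. g' x v) S" by (elim Ck_on_SucE) blast
  show ?case unfolding Ck_on.simps
    by (rule exI[of _ "\<lambda>x v. f' x v + g' x v"])
      (auto intro!: has_derivative_add f' g' Suc.IH)
qed

lemma Ck_on_sum:
  assumes "\<And>i. i \<in> I \<Longrightarrow> Ck_on k (f i) S"
  shows "Ck_on k (\<lambda>x. \<Sum>i\<in>I. f i x) S"
proof (cases "finite I")
  case True
  then show ?thesis using assms
    by (induction I) (auto intro: Ck_on_const Ck_on_add)
qed (auto intro: Ck_on_const)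

lemma Ck_on_bilinear:
  assumes "bounded_bilinear p" "Ck_on k f S" "Ck_on k g S"
  shows "Ck_on k (\<lambda>x. p (f x) (g x)) S"
  using assms(2,3)
proof (induction k arbitrary: f g)
  case 0
  then show ?case using bounded_bilinear.continuous_on[OF assms(1)] by auto
next
  case (Suc k)
  from Suc.prems(1) obtain f' where f': "\<And>x. x \<in> S \<Longrightarrow> (f has_derivative f' x) (at x within S)"
    "\<And>v. Ck_on k (\<lambda>x. f' x v) S" by (elim Ck_on_SucE) blast
  from Suc.prems(2) obtain g' where g': "\<And>x. x \<in> S \<Longrightarrow> (g has_derivative g' x) (at x within S)"
    "\<And>v. Ck_on k (\<lambda>x. g' x v) S" by (elim Ck_on_SucE) blast
  have fg: "Ck_on k f S" "Ck_on k g S" using Suc.prems Ck_on_Suc_imp by blast+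
  show ?case unfolding Ck_on.simps
    by (rule exI[of _ "\<lambda>x v. p (f x) (g' x v) + p (f' x v) (g x)"])
      (auto intro!: bounded_bilinear.FDERIV[OF assms(1)] f' g' Suc.IH Ck_on_add fg)
qed

text \<open>
  The chain rule gives (g o h)'(x) v = g'(h x)(h'(x) v). To see this as a C^k function of x for a
  fixed v, the inner vector is expanded in the basis, since the definition of C^k maps controls g'
  only in fixed directions.
\<close>

lemma Ck_on_compose:
  fixes g :: "'b::euclidean_space \<Rightarrow> 'c::real_normed_vector"
  assumes "Ck_on k h T" "Ck_on k g S" "h ` T \<subseteq> S"
  shows "Ck_on k (g \<circ> h) T"
  using assms(1,2)
proof (induction k arbitrary: g)
  case 0
  then show ?case using assms(3) continuous_on_compose continuous_on_subset
    by (metis Ck_on.simps(1))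
next
  case (Suc k)
  from Suc.prems(1) obtain h' where h': "\<And>x. x \<in> T \<Longrightarrow> (h has_derivative h' x) (at x within T)"
    "\<And>v. Ck_on k (\<lambda>x. h' x v) T" by (elim Ck_on_SucE) blast
  from Suc.prems(2) obtain g' where g': "\<And>x. x \<in> S \<Longrightarrow> (g has_derivative g' x) (at x within S)"
    "\<And>v. Ck_on k (\<lambda>x. g' x v) S" by (elim Ck_on_SucE) blast
  have hk: "Ck_on k h T" using Suc.prems Ck_on_Suc_imp by blast
  have 1: "(g \<circ> h has_derivative (g' (h x) \<circ> h' x)) (at x within T)" if "x \<in> T" for x
    using diff_chain_within[OF h'(1)[OF that], of g "g' (h x)"] g'(1)[of "h x"] that assms(3)
    by (meson has_derivative_subset image_subset_iff)
  have 2: "Ck_on k (\<lambda>x. (g' (h x) \<circ> h' x) v) T" for v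
  proof (rule Ck_on_cong_imp)
    show "Ck_on k (\<lambda>x. \<Sum>b\<in>Basis. (h' x v \<bullet> b) *\<^sub>R ((\<lambda>y. g' y b) \<circ> h) x) T"
      by (intro Ck_on_sum Ck_on_bilinear[OF bounded_bilinear_scaleR] Suc.IH hk g'(2)
          Ck_on_bilinear[OF bounded_bilinear_inner] h'(2) Ck_on_const)
    fix x assume x: "x \<in> T"
    have "linear (g' (h x))" using g'(1)[of "h x"] x assms(3)
      by (meson has_derivative_linear image_subset_iff)
    then show "(\<Sum>b\<in>Basis. (h' x v \<bullet> b) *\<^sub>R ((\<lambda>y. g' y b) \<circ> h) x) = (g' (h x) \<circ> h' x) v"
      using linear_sum linear_cmul euclidean_representation[of "h' x v"]
      by (smt (verit, ccfv_SIG) comp_apply sum.cong)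
  qed
  show ?case unfolding Ck_on.simps using 1 2
    by (intro exI[of _ "\<lambda>x. g' (h x) \<circ> h' x"]) blast
qed

text \<open>
  On an open set the derivative is unique, so the existential quantifier in the definition can be
  replaced by the Frechet derivative. This is what allows local statements to be glued.
\<close>

lemma Ck_on_open_Suc:
  fixes f :: "'a::euclidean_space \<Rightarrow> 'b::real_normed_vector"
  assumes "open S"
  shows "Ck_on (Suc k) f S \<longleftrightarrow>
    (\<forall>x\<in>S. f differentiable (at x)) \<and> (\<forall>v. Ck_on k (\<lambda>x. frechet_derivative f (at x) v) S)"
    (is "?L \<longleftrightarrow> ?R")
proof
  assume ?L
  then obtain f' where f': "\<And>x. x \<in> S \<Longrightarrow> (f has_derivative f' x) (at x within S)"
    "\<And>v. Ck_on k (\<lambda>x. f' x v) S" by auto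
  have d: "(f has_derivative f' x) (at x)" if "x \<in> S" for x
    using f'(1) that assms by (metis at_within_open)
  then have "f' x = frechet_derivative f (at x)" if "x \<in> S" for x
    using that frechet_derivative_at by blast
  then show ?R using d f'(2) Ck_on_cong_imp differentiable_def
    by (metis (mono_tags, lifting))
next
  assume ?R
  then show ?L unfolding Ck_on.simps
    by (intro exI[of _ "\<lambda>x. frechet_derivative f (at x)"])
      (auto simp: frechet_derivative_works intro: has_derivative_at_withinI)
qed

lemma Ck_on_local_open:
  fixes f :: "'a::euclidean_space \<Rightarrow> 'b::real_normed_vector"
  assumes "open S" "\<And>x. x \<in> S \<Longrightarrow> \<exists>T. open T \<and> x \<in> T \<and> Ck_on k f (S \<inter> T)"
  shows "Ck_on k f S"
  using assms(2)
proof (induction k arbitrary: f)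
  case 0
  show ?case unfolding Ck_on.simps continuous_on_eq_continuous_at[OF assms(1)]
  proof
    fix x assume "x \<in> S"
    with 0 obtain T where "open T" "x \<in> T" "continuous_on (S \<inter> T) f" by (metis Ck_on.simps(1))
    then show "isCont f x" using \<open>x \<in> S\<close> assms(1)
      by (meson IntI continuous_on_eq_continuous_at open_Int)
  qed
next
  case (Suc k)
  have o: "open (S \<inter> T)" if "open T" for T using that assms(1) by blast
  show ?case unfolding Ck_on_open_Suc[OF assms(1)]
  proof (intro conjI ballI allI)
    fix x assume "x \<in> S"
    with Suc.prems obtain T where "open T" "x \<in> T" "Ck_on (Suc k) f (S \<inter> T)" by blast
    then show "f differentiable at x" using \<open>x \<in> S\<close> Ck_on_open_Suc[OF o] by (metis IntI)
  next
    fix v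
    show "Ck_on k (\<lambda>x. frechet_derivative f (at x) v) S"
      by (rule Suc.IH) (metis Ck_on_open_Suc[OF o] Suc.prems)
  qed
qed


lemma smooth_on_subset: "smooth_on f S \<Longrightarrow> T \<subseteq> S \<Longrightarrow> smooth_on f T"
  using Ck_on_subset unfolding smooth_on_def by blast

lemma smooth_on_cong_imp: "smooth_on f S \<Longrightarrow> (\<And>x. x \<in> S \<Longrightarrow> f x = g x) \<Longrightarrow> smooth_on g S"
  using Ck_on_cong_imp unfolding smooth_on_def by blast

lemma smooth_on_const: "smooth_on (\<lambda>x. c) S"
  unfolding smooth_on_def by (simp add: Ck_on_const)

lemma smooth_on_bounded_linear: "bounded_linear h \<Longrightarrow> smooth_on h S"
  unfolding smooth_on_def by (simp add: Ck_on_bounded_linear)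

lemma smooth_on_add: "smooth_on f S \<Longrightarrow> smooth_on g S \<Longrightarrow> smooth_on (\<lambda>x. f x + g x) S"
  unfolding smooth_on_def by (simp add: Ck_on_add)

lemma smooth_on_bilinear:
  "bounded_bilinear p \<Longrightarrow> smooth_on f S \<Longrightarrow> smooth_on g S \<Longrightarrow> smooth_on (\<lambda>x. p (f x) (g x)) S"
  unfolding smooth_on_def by (simp add: Ck_on_bilinear)

lemma smooth_on_compose:
  fixes g :: "'b::euclidean_space \<Rightarrow> 'c::real_normed_vector"
  shows "smooth_on h T \<Longrightarrow> smooth_on g S \<Longrightarrow> h ` T \<subseteq> S \<Longrightarrow> smooth_on (g \<circ> h) T"
  unfolding smooth_on_def using Ck_on_compose by blast

lemma smooth_on_continuous: "smooth_on f S \<Longrightarrow> continuous_on S f"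
  unfolding smooth_on_def by (metis Ck_on.simps(1))

lemma smooth_on_open:
  fixes f :: "'a::euclidean_space \<Rightarrow> 'b::real_normed_vector"
  assumes "open S" "smooth_on f S"
  shows "x \<in> S \<Longrightarrow> f differentiable (at x)"
    and "smooth_on (\<lambda>x. frechet_derivative f (at x) v) S"
  using assms Ck_on_open_Suc unfolding smooth_on_def by blast+

text \<open>
  The orthogonal projection onto span B, for B a set of standard basis vectors.
\<close>

definition coord_proj :: "'e::euclidean_space set \<Rightarrow> 'e \<Rightarrow> 'e" where
  "coord_proj B z = (\<Sum>b\<in>B. (z \<bullet> b) *\<^sub>R b)"

lemma bounded_linear_coord_proj: "bounded_linear (coord_proj B)"
  unfolding coord_proj_def by (intro bounded_linear_sum bounded_linear_scaleR_const
      bounded_linear_inner_left)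

lemma coord_proj_id:
  assumes "B \<subseteq> Basis" "z \<in> span B"
  shows "coord_proj B z = z"
  using assms(2)
proof (induction rule: span_induct_alt)
  case base
  then show ?case by (simp add: coord_proj_def)
next
  case (step c x y)
  have lin: "linear (coord_proj B)" using bounded_linear_coord_proj bounded_linear.linear by blast
  have fB: "finite B" using assms(1) finite_Basis finite_subset by blast
  have "coord_proj B x = (\<Sum>b\<in>B. if b = x then x else 0)"
    unfolding coord_proj_def using assms(1) step.hyps
    by (intro sum.cong) (auto simp: inner_Basis subset_iff)
  then have "coord_proj B x = x" using step.hyps fB by simp
  then show ?case using step.IH lin by (simp add: linear_add linear_cmul)
qed

lemma coord_proj_in_span: "coord_proj B z \<in> span B"
  unfolding coord_proj_def by (intro span_sum span_scale span_base)

lemma open_vimage_coord_proj: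
  assumes "openin (top_of_set (span B)) S"
  shows "open (coord_proj B -` S)"
proof -
  obtain T where T: "open T" "S = span B \<inter> T" using assms by (auto simp: openin_open)
  then have "coord_proj B -` S = coord_proj B -` T" using coord_proj_in_span by auto
  moreover have "continuous_on UNIV (coord_proj B)"
    using bounded_linear_coord_proj linear_continuous_on by blast
  ultimately show ?thesis using T(1) by (metis open_vimage)
qed

text \<open>
  Derivatives within a relatively open subset of span B are not unique, so local derivatives cannot
  be glued directly. Precomposition with the projection onto span B moves the question to an open
  subset of the whole space, where they are.
\<close>

lemma smooth_on_local:
  fixes f :: "'e::euclidean_space \<Rightarrow> 'b::real_normed_vector"
  assumes "B \<subseteq> Basis" "openin (top_of_set (span B)) S"
    and loc: "\<And>x. x \<in> S \<Longrightarrow> \<exists>T. open T \<and> x \<in> T \<and> smooth_on f (S \<inter> T)"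
  shows "smooth_on f S"
proof -
  let ?p = "coord_proj B"
  let ?S = "?p -` S"
  have S: "S \<subseteq> span B" using assms(2) openin_imp_subset by fastforce
  have fp: "smooth_on (f \<circ> ?p) ?S" unfolding smooth_on_def
  proof (intro allI Ck_on_local_open)
    show "open ?S" using open_vimage_coord_proj assms(2) by blast
    fix k x assume "x \<in> ?S"
    with loc obtain T where T: "open T" "?p x \<in> T" "smooth_on f (S \<inter> T)" by auto
    have "smooth_on (f \<circ> ?p) (?S \<inter> ?p -` T)"
      by (rule smooth_on_compose[OF smooth_on_bounded_linear[OF bounded_linear_coord_proj] T(3)]) auto
    moreover have "open (?p -` T)" using T(1) bounded_linear_coord_proj linear_continuous_on
      by (metis open_vimage)
    ultimately show "\<exists>T. open T \<and> x \<in> T \<and> Ck_on k (f \<circ> ?p) (?S \<inter> T)"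
      using T(2) unfolding smooth_on_def by blast
  qed
  have "S \<subseteq> ?S" using S coord_proj_id[OF assms(1)] by auto
  then have "smooth_on (f \<circ> ?p) S" using fp smooth_on_subset by blast
  then show ?thesis by (rule smooth_on_cong_imp) (use S coord_proj_id[OF assms(1)] in auto)
qed

section \<open>Hadamard's lemma\<close>

text \<open>
  Differentiation under the integral sign, iterated: the derivative of the integral in direction v
  is again a parameter integral, of the derivative of G in direction (v, 0).
\<close>

lemma Ck_on_integral_parameter:
  fixes G :: "'e::euclidean_space \<times> real \<Rightarrow> real"
  assumes "convex C" "Ck_on k G (C \<times> cbox 0 1)"
  shows "Ck_on k (\<lambda>z. integral (cbox 0 1) (\<lambda>t. G (z, t))) C"
  using assms(2)
proof (induction k arbitrary: G)
  case 0
  then have "continuous_on (C \<times> cbox 0 1) (\<lambda>(z, t). G (z, t))" by simp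
  from integral_continuous_on_param[OF this] show ?case by simp
next
  case (Suc k)
  then obtain G' where G': "\<And>p. p \<in> C \<times> cbox 0 1 \<Longrightarrow> (G has_derivative G' p) (at p within C \<times> cbox 0 1)"
    "\<And>v. Ck_on k (\<lambda>p. G' p v) (C \<times> cbox 0 1)" by auto
  have cont: "continuous_on (C \<times> cbox 0 1) (\<lambda>p. G' p v)" for v
    using G'(2)[of v]
  proof (induction k)
    case (Suc k) then show ?case using Ck_on_Suc_imp by blast
  qed simp
  \<comment> \<open>The partial derivative in z, packaged as a bounded linear map as \<open>leibniz_rule\<close> requires.\<close>
  define H where "H z t = Blinfun (\<lambda>v. G' (z, t) (v, 0))" for z t
  have H: "blinfun_apply (H z t) = (\<lambda>v. G' (z, t) (v, 0))" if "z \<in> C" "t \<in> cbox 0 1" for z t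
  proof -
    have "bounded_linear (G' (z, t))" using G'(1)[of "(z, t)"] that
      by (auto intro: has_derivative_bounded_linear)
    then have "bounded_linear (\<lambda>v. G' (z, t) (v, 0))"
      using bounded_linear_compose bounded_linear_Pair bounded_linear_ident bounded_linear_zero by blast
    then show ?thesis unfolding H_def by (simp add: bounded_linear_Blinfun_apply)
  qed
  have Hcont: "continuous_on (C \<times> cbox 0 1) (\<lambda>(z, t). H z t)"
  proof (rule continuous_on_blinfun_componentwise)
    fix i :: 'e
    have "continuous_on (C \<times> cbox 0 1) (\<lambda>p. G' p (i, 0))" using cont .
    then show "continuous_on (C \<times> cbox 0 1) (\<lambda>x. blinfun_apply (case x of (z, t) \<Rightarrow> H z t) i)"
      by (rule continuous_on_eq) (auto simp: H)
  qed
  have der: "((\<lambda>z. integral (cbox 0 1) (\<lambda>t. G (z, t))) has_derivative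
      blinfun_apply (integral (cbox 0 1) (H z))) (at z within C)" if z: "z \<in> C" for z
  proof (rule leibniz_rule[where f = "\<lambda>z t. G (z, t)" and fx = H, OF _ _ Hcont z assms(1)])
    fix z t assume zt: "z \<in> C" "t \<in> cbox (0::real) 1"
    have "((\<lambda>z. (z, t)) has_derivative (\<lambda>v. (v, 0))) (at z within C)"
      by (intro derivative_intros)
    moreover have "(G has_derivative G' (z, t)) (at (z, t) within (\<lambda>z. (z, t)) ` C)"
      using G'(1)[of "(z, t)"] zt by (auto intro: has_derivative_subset)
    ultimately show "((\<lambda>z. G (z, t)) has_derivative blinfun_apply (H z t)) (at z within C)"
      using diff_chain_within[of "\<lambda>z. (z, t)" "\<lambda>v. (v, 0)" z C G "G' (z, t)"] H[OF zt]
      by (simp add: o_def)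
  next
    fix z assume "z \<in> C"
    have "continuous_on (C \<times> cbox 0 1) G" using Suc.prems
      by (auto simp: continuous_on_eq_continuous_within intro: has_derivative_continuous)
    then have "continuous_on (cbox 0 1) (\<lambda>t. G (z, t))"
      using \<open>z \<in> C\<close> by (intro continuous_on_compose2[where g = G and f = "\<lambda>t. (z, t)"] continuous_intros) auto
    then show "(\<lambda>t. G (z, t)) integrable_on cbox 0 1" by (rule integrable_continuous)
  qed
  have ap: "blinfun_apply (integral (cbox 0 1) (H z)) v = integral (cbox 0 1) (\<lambda>t. G' (z, t) (v, 0))"
    if "z \<in> C" for z v
  proof -
    have "continuous_on (cbox 0 1) (\<lambda>t. H z t)"
      using Hcont that by (intro continuous_on_compose2[where g = "\<lambda>(z, t). H z t" and f = "\<lambda>t. (z, t)", simplified] continuous_intros) auto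
    then have "H z integrable_on cbox 0 1" by (rule integrable_continuous)
    then have "blinfun_apply (integral (cbox 0 1) (H z)) v = integral (cbox 0 1) (\<lambda>t. blinfun_apply (H z t) v)"
      by (simp add: blinfun_apply_integral)
    also have "\<dots> = integral (cbox 0 1) (\<lambda>t. G' (z, t) (v, 0))"
      using H[OF that] by (intro integral_cong) simp
    finally show ?thesis .
  qed
  have "Ck_on k (\<lambda>z. blinfun_apply (integral (cbox 0 1) (H z)) v) C" for v
    by (rule Ck_on_cong_imp[OF Suc.IH[OF G'(2)[of "(v, 0)"]]]) (simp only: ap)
  then show ?case unfolding Ck_on.simps using der
    by (intro exI[of _ "\<lambda>z. blinfun_apply (integral (cbox 0 1) (H z))"]) blast
qed

text \<open>
  Integrate the derivative of f along the segment from a to z: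
  f z - f a is the integral of f'(a + t (z - a))(z - a) over t in [0, 1], and
  g b z is the integral of f'(a + t (z - a)) b.
\<close>

lemma hadamard:
  fixes f :: "'e::euclidean_space \<Rightarrow> real"
  assumes "open S" "a \<in> S" "smooth_on f S"
  shows "\<exists>r>0. \<exists>g. (\<forall>b. smooth_on (g b) (ball a r)) \<and>
    (\<forall>z\<in>ball a r. f z = f a + (\<Sum>b\<in>Basis. ((z - a) \<bullet> b) * g b z)) \<and>
    (\<forall>b. g b a = frechet_derivative f (at a) b)"
proof -
  obtain r where r: "r > 0" "ball a r \<subseteq> S" using assms(1,2) openE by blast
  let ?D = "\<lambda>z. frechet_derivative f (at z)"
  \<comment> \<open>The segment from a to z, parametrised by [0, 1], as a smooth function of the pair (z, t).\<close>
  define h where "h p = a + snd p *\<^sub>R (fst p - a)" for p :: "'e \<times> real"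
  define g where "g b z = integral (cbox 0 1) (\<lambda>t. ((\<lambda>z. ?D z b) \<circ> h) (z, t))" for b z
  have fst_snd: "smooth_on (\<lambda>p. snd p) C" "smooth_on (\<lambda>p. fst p) C" for C :: "('e \<times> real) set"
    by (auto intro: smooth_on_bounded_linear bounded_linear_fst bounded_linear_snd)
  have hs: "smooth_on h C" for C
    unfolding h_def using smooth_on_add[OF fst_snd(2) smooth_on_const[of "- a"], of C]
    by (intro smooth_on_add smooth_on_const smooth_on_bilinear[OF bounded_bilinear_scaleR] fst_snd) simp
  have him: "h ` (ball a r \<times> cbox 0 1) \<subseteq> ball a r"
  proof clarify
    fix z t assume "z \<in> ball a r" "t \<in> cbox (0::real) 1"
    then have "norm (t *\<^sub>R (z - a)) \<le> norm (z - a)" "norm (z - a) < r"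
      by (auto simp: mult_left_le_one_le dist_norm norm_minus_commute)
    then show "h (z, t) \<in> ball a r" unfolding h_def by (simp add: dist_norm)
  qed
  have df: "smooth_on (\<lambda>z. ?D z b) (ball a r)" for b
    using smooth_on_open(2)[OF assms(1,3)] r(2) smooth_on_subset by blast
  have Gs: "smooth_on ((\<lambda>z. ?D z b) \<circ> h) (ball a r \<times> cbox 0 1)" for b
    using smooth_on_compose[OF hs df him] .
  have gs: "smooth_on (g b) (ball a r)" for b
    unfolding g_def smooth_on_def using Gs[of b, unfolded smooth_on_def]
    by (intro allI Ck_on_integral_parameter convex_ball) blast
  have fz: "f z = f a + (\<Sum>b\<in>Basis. ((z - a) \<bullet> b) * g b z)" if z: "z \<in> ball a r" for z
  proof -
    have der: "((\<lambda>t. f (h (z, t))) has_vector_derivative ?D (h (z, t)) (z - a)) (at t within {0..1})"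
      if t: "t \<in> {0..1}" for t
    proof -
      have "h (z, t) \<in> S" using him z t r(2) by fastforce
      then have "(f has_derivative ?D (h (z, t))) (at (h (z, t)))"
        using smooth_on_open(1)[OF assms(1,3)] by (simp add: frechet_derivative_works)
      moreover have "((\<lambda>t. h (z, t)) has_derivative (\<lambda>s. s *\<^sub>R (z - a))) (at t within {0..1})"
        unfolding h_def by (auto intro!: derivative_eq_intros)
      ultimately have "((\<lambda>t. f (h (z, t))) has_derivative (\<lambda>s. ?D (h (z, t)) (s *\<^sub>R (z - a)))) (at t within {0..1})"
        using has_derivative_compose by blast
      moreover have "linear (?D (h (z, t)))"
        using \<open>(f has_derivative ?D (h (z, t))) (at (h (z, t)))\<close> has_derivative_linear by blast
      ultimately show ?thesis unfolding has_vector_derivative_def by (simp add: linear_cmul)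
    qed
    have I: "((\<lambda>t. ?D (h (z, t)) (z - a)) has_integral f (h (z, 1)) - f (h (z, 0))) {0..1}"
      by (rule fundamental_theorem_of_calculus) (use der in auto)
    have int: "(\<lambda>t. ((\<lambda>z. ?D z b) \<circ> h) (z, t)) integrable_on cbox 0 1" for b
    proof (rule integrable_continuous, rule continuous_on_compose2[OF smooth_on_continuous[OF Gs[of b]]])
      show "continuous_on (cbox 0 1) (\<lambda>t. (z, t))" by (intro continuous_intros)
    qed (use z in auto)
    have "((\<lambda>t. \<Sum>b\<in>Basis. ((z - a) \<bullet> b) * ((\<lambda>z. ?D z b) \<circ> h) (z, t)) has_integral
        (\<Sum>b\<in>Basis. ((z - a) \<bullet> b) * g b z)) (cbox 0 1)"
      unfolding g_def by (intro has_integral_sum has_integral_mult_right integrable_integral int) auto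
    moreover have "(\<Sum>b\<in>Basis. ((z - a) \<bullet> b) * ((\<lambda>z. ?D z b) \<circ> h) (z, t)) = ?D (h (z, t)) (z - a)"
      if t: "t \<in> {0..1}" for t
    proof -
      have "h (z, t) \<in> S" using him z t r(2) by fastforce
      then have lin: "linear (?D (h (z, t)))"
        using smooth_on_open(1)[OF assms(1,3)] by (simp add: linear_frechet_derivative)
      have "?D (h (z, t)) (z - a) = ?D (h (z, t)) (\<Sum>b\<in>Basis. ((z - a) \<bullet> b) *\<^sub>R b)"
        by (simp only: euclidean_representation)
      then show ?thesis by (simp add: linear_sum[OF lin] linear_cmul[OF lin])
    qed
    ultimately have "((\<lambda>t. ?D (h (z, t)) (z - a)) has_integral (\<Sum>b\<in>Basis. ((z - a) \<bullet> b) * g b z)) {0..1}"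
      by (metis (mono_tags, lifting) box_real(2) has_integral_eq)
    then have "(\<Sum>b\<in>Basis. ((z - a) \<bullet> b) * g b z) = f (h (z, 1)) - f (h (z, 0))"
      using I has_integral_unique by blast
    then show ?thesis unfolding h_def by simp
  qed
  have "g b a = ?D a b" for b unfolding g_def h_def by simp
  then show ?thesis using r(1) gs fz by (intro exI[of _ r] exI[of _ g] conjI allI ballI)
qed

section \<open>Smooth functions on manifolds\<close>

lemma smooth_funD:
  "smooth_fun A W f \<Longrightarrow> (U, \<phi>) \<in> A \<Longrightarrow> smooth_on (f \<circ> inv_into U \<phi>) (\<phi> ` (U \<inter> W))"
  unfolding smooth_fun_def by auto

lemma smooth_fun_subset: "smooth_fun A W f \<Longrightarrow> V \<subseteq> W \<Longrightarrow> smooth_fun A V f"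
  unfolding smooth_fun_def by (fast elim!: smooth_on_subset)

locale atlas_manifold =
  fixes B :: "'e::euclidean_space set"
    and A :: "('m::{t2_space,second_countable_topology}, 'e) atlas"
  assumes manifold: "smooth_manifold B A"
begin

lemma B_Basis: "B \<subseteq> Basis"
  using manifold unfolding smooth_manifold_def by (rule conjunct1)

lemma charts_cover: "(\<Union>(U, \<phi>)\<in>A. U) = UNIV"
  using manifold[unfolded smooth_manifold_def, THEN conjunct2, THEN conjunct1] .

lemma chart_at: obtains U \<phi> where "(U, \<phi>) \<in> A" "x \<in> U"
proof -
  have "x \<in> (\<Union>(U, \<phi>)\<in>A. U)" using charts_cover by simp
  then show thesis using that by auto
qed

lemma chart_props:
  assumes "(U, \<phi>) \<in> A"
  shows "open U" "openin (top_of_set (span B)) (\<phi> ` U)"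
    "homeomorphism U (\<phi> ` U) \<phi> (inv_into U \<phi>)"
  using manifold[unfolded smooth_manifold_def, THEN conjunct2, THEN conjunct2, THEN conjunct1,
      THEN bspec, OF assms] by simp_all

lemma transition_smooth:
  assumes "(U, \<phi>) \<in> A" "(V, \<psi>) \<in> A"
  shows "smooth_on (\<psi> \<circ> inv_into U \<phi>) (\<phi> ` (U \<inter> V))"
  using manifold[unfolded smooth_manifold_def, THEN conjunct2, THEN conjunct2, THEN conjunct2,
      THEN bspec, OF assms(1)] assms(2) by auto

lemma inv_into_chart: "(U, \<phi>) \<in> A \<Longrightarrow> y \<in> U \<Longrightarrow> inv_into U \<phi> (\<phi> y) = y"
  using chart_props(3) homeomorphism_apply1 by blast

lemma openin_chart_image:
  assumes "(U, \<phi>) \<in> A" "open W"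
  shows "openin (top_of_set (span B)) (\<phi> ` (U \<inter> W))"
proof -
  have "openin (top_of_set (\<phi> ` U)) (\<phi> ` (U \<inter> W))"
    using homeomorphism_imp_open_map[OF chart_props(3)[OF assms(1)]] assms(2)
    by (simp add: openin_open_Int)
  then show ?thesis using chart_props(2)[OF assms(1)] openin_trans by blast
qed

text \<open>
  By smoothness of the transition maps, one chart suffices to test smoothness near a point.
\<close>

lemma smooth_near_chartI:
  assumes U: "(U, \<phi>) \<in> A" and W: "open W" "x \<in> W" "W \<subseteq> U"
    and f: "smooth_on (f \<circ> inv_into U \<phi>) (\<phi> ` W)"
  shows "f \<in> smooth_near A x"
proof -
  have "smooth_on (f \<circ> inv_into V \<psi>) (\<psi> ` (V \<inter> W))" if V: "(V, \<psi>) \<in> A" for V \<psi>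
  proof (rule smooth_on_cong_imp)
    have "smooth_on (\<phi> \<circ> inv_into V \<psi>) (\<psi> ` (V \<inter> W))"
      by (rule smooth_on_subset[OF transition_smooth[OF V U]]) (use W(3) in auto)
    then show "smooth_on ((f \<circ> inv_into U \<phi>) \<circ> (\<phi> \<circ> inv_into V \<psi>)) (\<psi> ` (V \<inter> W))"
      by (rule smooth_on_compose[OF _ f]) (use inv_into_chart[OF V] in auto)
  qed (use inv_into_chart[OF V] inv_into_chart[OF U] W(3) in auto)
  then show ?thesis unfolding smooth_near_def smooth_fun_def using W by blast
qed

lemma smooth_fun_imp_near: "smooth_fun A W f \<Longrightarrow> open W \<Longrightarrow> x \<in> W \<Longrightarrow> f \<in> smooth_near A x"
  unfolding smooth_near_def by blast

text \<open>
  Smoothness is a local property. Together with \<open>smooth_fun_imp_near\<close> this allows all smoothness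
  proofs to be carried out pointwise in terms of germs.
\<close>

lemma smooth_funI:
  assumes "\<And>x. x \<in> W \<Longrightarrow> f \<in> smooth_near A x" "open W"
  shows "smooth_fun A W f"
  unfolding smooth_fun_def
proof (clarify)
  fix V \<psi> assume V: "(V, \<psi>) \<in> A"
  let ?S = "\<psi> ` (V \<inter> W)"
  have S: "openin (top_of_set (span B)) ?S" using openin_chart_image[OF V assms(2)] .
  show "smooth_on (f \<circ> inv_into V \<psi>) ?S"
  proof (rule smooth_on_local[OF B_Basis S])
    fix z assume "z \<in> ?S"
    then obtain y where y: "z = \<psi> y" "y \<in> V" "y \<in> W" by blast
    then obtain W' where W': "open W'" "y \<in> W'" "smooth_fun A W' f"
      using assms(1) unfolding smooth_near_def by blast
    then obtain T where T: "open T" "\<psi> ` (V \<inter> W') = span B \<inter> T"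
      using openin_chart_image[OF V] by (auto simp: openin_open)
    have "smooth_on (f \<circ> inv_into V \<psi>) (\<psi> ` (V \<inter> W'))"
      using W'(3) V unfolding smooth_fun_def by blast
    moreover have "?S \<inter> T \<subseteq> \<psi> ` (V \<inter> W')"
      unfolding T(2) using openin_imp_subset[OF S] by auto
    moreover have "z \<in> T" using T(2) y W'(2) by blast
    ultimately show "\<exists>T. open T \<and> z \<in> T \<and> smooth_on (f \<circ> inv_into V \<psi>) (?S \<inter> T)"
      using T(1) smooth_on_subset by blast
  qed
qed

lemma smooth_near_eventually:
  assumes "f \<in> smooth_near A x"
  shows "\<forall>\<^sub>F y in nhds x. f \<in> smooth_near A y"
  using assms unfolding smooth_near_def eventually_nhds by blast

lemma smooth_near_cong:
  assumes "f \<in> smooth_near A x" "\<forall>\<^sub>F y in nhds x. f y = g y"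
  shows "g \<in> smooth_near A x"
proof -
  obtain W where W: "open W" "x \<in> W" "smooth_fun A W f"
    using assms(1) unfolding smooth_near_def by blast
  obtain V where V: "open V" "x \<in> V" "\<And>y. y \<in> V \<Longrightarrow> f y = g y"
    using assms(2) unfolding eventually_nhds by blast
  have "smooth_fun A (W \<inter> V) g" unfolding smooth_fun_def
  proof clarify
    fix U \<phi> assume U: "(U, \<phi>) \<in> A"
    have "smooth_on (f \<circ> inv_into U \<phi>) (\<phi> ` (U \<inter> W))"
      using W(3) U unfolding smooth_fun_def by blast
    then have "smooth_on (f \<circ> inv_into U \<phi>) (\<phi> ` (U \<inter> (W \<inter> V)))"
      by (rule smooth_on_subset) blast
    then show "smooth_on (g \<circ> inv_into U \<phi>) (\<phi> ` (U \<inter> (W \<inter> V)))"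
      by (rule smooth_on_cong_imp) (use inv_into_chart[OF U] V(3) in auto)
  qed
  then show ?thesis unfolding smooth_near_def using W V by blast
qed

lemma smooth_near_const: "(\<lambda>y. c) \<in> smooth_near A x"
  unfolding smooth_near_def smooth_fun_def using smooth_on_const
  by (auto simp: comp_def intro!: exI[of _ UNIV])

lemma smooth_near_binary:
  assumes "f \<in> smooth_near A x" "g \<in> smooth_near A x"
    and op: "\<And>f g (S :: 'e set). smooth_on f S \<Longrightarrow> smooth_on g S \<Longrightarrow> smooth_on (\<lambda>z. p (f z) (g z)) S"
  shows "(\<lambda>y. p (f y) (g y)) \<in> smooth_near A x"
proof -
  obtain W where W: "open W" "x \<in> W" "smooth_fun A W f"
    using assms(1) unfolding smooth_near_def by blast
  obtain V where V: "open V" "x \<in> V" "smooth_fun A V g"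
    using assms(2) unfolding smooth_near_def by blast
  have fg: "smooth_fun A (W \<inter> V) f" "smooth_fun A (W \<inter> V) g"
    using W V smooth_fun_subset by blast+
  have "smooth_fun A (W \<inter> V) (\<lambda>y. p (f y) (g y))"
    unfolding smooth_fun_def
  proof clarify
    fix U \<phi> assume U: "(U, \<phi>) \<in> A"
    have "smooth_on (\<lambda>z. p ((f \<circ> inv_into U \<phi>) z) ((g \<circ> inv_into U \<phi>) z)) (\<phi> ` (U \<inter> (W \<inter> V)))"
      by (rule op) (use fg U smooth_funD in \<open>blast+\<close>)
    then show "smooth_on ((\<lambda>y. p (f y) (g y)) \<circ> inv_into U \<phi>) (\<phi> ` (U \<inter> (W \<inter> V)))"
      by (simp add: comp_def)
  qed
  then show ?thesis unfolding smooth_near_def using W V by blast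
qed

lemma smooth_near_add:
  "f \<in> smooth_near A x \<Longrightarrow> g \<in> smooth_near A x \<Longrightarrow> (\<lambda>y. f y + g y) \<in> smooth_near A x"
  by (rule smooth_near_binary) (auto intro: smooth_on_add)

lemma smooth_near_mult:
  "f \<in> smooth_near A x \<Longrightarrow> g \<in> smooth_near A x \<Longrightarrow> (\<lambda>y. f y * g y) \<in> smooth_near A x"
  by (rule smooth_near_binary) (auto intro: smooth_on_bilinear bounded_bilinear_mult)

lemma smooth_near_diff:
  assumes "f \<in> smooth_near A x" "g \<in> smooth_near A x"
  shows "(\<lambda>y. f y - g y) \<in> smooth_near A x"
  using smooth_near_add[OF assms(1) smooth_near_mult[OF smooth_near_const[of "-1"] assms(2)]] by simp

lemma smooth_near_sum:
  "(\<And>i. i \<in> I \<Longrightarrow> f i \<in> smooth_near A x) \<Longrightarrow> (\<lambda>y. \<Sum>i\<in>I. f i y) \<in> smooth_near A x"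
  by (induction I rule: infinite_finite_induct) (auto intro: smooth_near_const smooth_near_add)

lemma smooth_near_isCont:
  assumes "f \<in> smooth_near A x"
  shows "isCont f x"
proof -
  obtain W where W: "open W" "x \<in> W" "smooth_fun A W f"
    using assms(1) unfolding smooth_near_def by blast
  obtain U \<phi> where U: "(U, \<phi>) \<in> A" "x \<in> U" using chart_at .
  have "continuous_on (\<phi> ` (U \<inter> W)) (f \<circ> inv_into U \<phi>)"
    using W(3) U(1) smooth_on_continuous unfolding smooth_fun_def by blast
  moreover have "continuous_on (U \<inter> W) \<phi>"
    using chart_props(3)[OF U(1)] homeomorphism_cont1 continuous_on_subset by blast
  ultimately have "continuous_on (U \<inter> W) ((f \<circ> inv_into U \<phi>) \<circ> \<phi>)"
    using continuous_on_compose by blast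
  then have "continuous_on (U \<inter> W) f"
    by (rule continuous_on_eq) (use inv_into_chart[OF U(1)] in auto)
  moreover have "open (U \<inter> W)" using chart_props(1)[OF U(1)] W(1) by blast
  ultimately show ?thesis using U(2) W(2) by (simp add: continuous_on_eq_continuous_at)
qed

section \<open>Tangent and cotangent vectors\<close>

lemma tangent_lin:
  "v \<in> tangent_space A x \<Longrightarrow> f \<in> smooth_near A x \<Longrightarrow> g \<in> smooth_near A x \<Longrightarrow>
    v (\<lambda>y. c * f y + d * g y) = c * v f + d * v g"
  unfolding tangent_space_def by blast

lemma tangent_mult:
  "v \<in> tangent_space A x \<Longrightarrow> f \<in> smooth_near A x \<Longrightarrow> g \<in> smooth_near A x \<Longrightarrow>
    v (\<lambda>y. f y * g y) = f x * v g + g x * v f"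
  unfolding tangent_space_def by blast

lemma tangent_not_smooth:
  "v \<in> tangent_space A x \<Longrightarrow> f \<notin> smooth_near A x \<Longrightarrow> v f = 0"
  unfolding tangent_space_def by blast

lemma tangent_add:
  assumes "v \<in> tangent_space A x" "f \<in> smooth_near A x" "g \<in> smooth_near A x"
  shows "v (\<lambda>y. f y + g y) = v f + v g"
  using tangent_lin[OF assms, of 1 1] by simp

lemma tangent_diff:
  assumes "v \<in> tangent_space A x" "f \<in> smooth_near A x" "g \<in> smooth_near A x"
  shows "v (\<lambda>y. f y - g y) = v f - v g"
  using tangent_lin[OF assms, of 1 "-1"] by simp

lemma tangent_const:
  assumes "v \<in> tangent_space A x"
  shows "v (\<lambda>y. c) = 0"
proof -
  have "v (\<lambda>y. 1) = 0"
    using tangent_mult[OF assms smooth_near_const smooth_near_const, of 1 1] by simp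
  then show ?thesis
    using tangent_lin[OF assms smooth_near_const smooth_near_const, of c 1 0 1] by simp
qed

lemma tangent_sum:
  assumes "v \<in> tangent_space A x" "\<And>i. i \<in> I \<Longrightarrow> f i \<in> smooth_near A x"
  shows "v (\<lambda>y. \<Sum>i\<in>I. f i y) = (\<Sum>i\<in>I. v (f i))"
  using assms(2)
  by (induction I rule: infinite_finite_induct)
    (auto simp: tangent_const[OF assms(1)] tangent_add[OF assms(1)] smooth_near_sum)

text \<open>
  If f and g agree on a neighbourhood W of x, then f - g = (f - g) c for c the indicator function of
  the complement of W, which is smooth near x. Both factors vanish at x, so the product rule gives
  v (f - g) = 0.
\<close>

lemma tangent_cong:
  assumes v: "v \<in> tangent_space A x" and fg: "\<forall>\<^sub>F y in nhds x. f y = g y"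
  shows "v f = v g"
proof (cases "f \<in> smooth_near A x")
  case True
  then have g: "g \<in> smooth_near A x" using fg smooth_near_cong by blast
  obtain W where W: "open W" "x \<in> W" "\<And>y. y \<in> W \<Longrightarrow> f y = g y"
    using fg unfolding eventually_nhds by blast
  define cut :: "'m \<Rightarrow> real" where "cut y = (if y \<in> W then 0 else 1)" for y
  have cut: "cut \<in> smooth_near A x"
    using smooth_near_const[of 0 x] by (rule smooth_near_cong) (use W in \<open>auto simp: eventually_nhds cut_def\<close>)
  have h: "(\<lambda>y. f y - g y) \<in> smooth_near A x" using True g smooth_near_diff by blast
  have "v (\<lambda>y. (f y - g y) * cut y) = 0"
    using tangent_mult[OF v h cut] W by (simp add: cut_def)
  moreover have "(\<lambda>y. (f y - g y) * cut y) = (\<lambda>y. f y - g y)" using W(3) by (auto simp: cut_def)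
  ultimately show ?thesis using tangent_diff[OF v True g] by simp
next
  case False
  have "\<forall>\<^sub>F y in nhds x. g y = f y" using fg by eventually_elim simp
  then have "g \<notin> smooth_near A x" using False smooth_near_cong by blast
  with False show ?thesis using v tangent_not_smooth by metis
qed

lemma tangent_spaceI:
  assumes "\<And>f g c d. f \<in> smooth_near A x \<Longrightarrow> g \<in> smooth_near A x \<Longrightarrow>
      v (\<lambda>y. c * f y + d * g y) = c * v f + d * v g"
    and "\<And>f g. f \<in> smooth_near A x \<Longrightarrow> g \<in> smooth_near A x \<Longrightarrow> v (\<lambda>y. f y * g y) = f x * v g + g x * v f"
    and "\<And>f. f \<notin> smooth_near A x \<Longrightarrow> v f = 0"
  shows "v \<in> tangent_space A x"
  unfolding tangent_space_def using assms by blast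

lemma tangent_space_lin:
  assumes "u \<in> tangent_space A x" "v \<in> tangent_space A x"
  shows "(\<lambda>f. c * u f + d * v f) \<in> tangent_space A x"
  by (rule tangent_spaceI)
    (auto simp: tangent_lin[OF assms(1)] tangent_lin[OF assms(2)] tangent_mult[OF assms(1)]
      tangent_mult[OF assms(2)] tangent_not_smooth[OF assms(1)] tangent_not_smooth[OF assms(2)] algebra_simps)

lemma tangent_space_zero: "(\<lambda>f. 0) \<in> tangent_space A x"
  by (rule tangent_spaceI) auto

lemma tangent_space_sum:
  assumes "\<And>i. i \<in> I \<Longrightarrow> u i \<in> tangent_space A x"
  shows "(\<lambda>f. \<Sum>i\<in>I. c i * u i f) \<in> tangent_space A x"
  using assms
proof (induction I rule: infinite_finite_induct)
  case (insert i I)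
  then have "(\<lambda>f. c i * u i f + 1 * (\<Sum>i\<in>I. c i * u i f)) \<in> tangent_space A x"
    by (intro tangent_space_lin) auto
  with insert.hyps show ?case by simp
qed (auto intro: tangent_space_zero)

lemma cotangent_lin:
  assumes "a \<in> cotangent_space A x" "u \<in> tangent_space A x" "v \<in> tangent_space A x"
  shows "a (\<lambda>f. c * u f + d * v f) = c * a u + d * a v"
  using assms unfolding cotangent_space_def by blast

lemma cotangent_not_tangent: "a \<in> cotangent_space A x \<Longrightarrow> v \<notin> tangent_space A x \<Longrightarrow> a v = 0"
  unfolding cotangent_space_def by blast

lemma cotangent_sum:
  assumes a: "a \<in> cotangent_space A x" and "\<And>i. i \<in> I \<Longrightarrow> u i \<in> tangent_space A x"
  shows "a (\<lambda>f. \<Sum>i\<in>I. c i * u i f) = (\<Sum>i\<in>I. c i * a (u i))"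
  using assms(2)
proof (induction I rule: infinite_finite_induct)
  case (insert i I)
  have "a (\<lambda>f. c i * u i f + 1 * (\<Sum>i\<in>I. c i * u i f)) = c i * a (u i) + 1 * a (\<lambda>f. \<Sum>i\<in>I. c i * u i f)"
    using insert by (intro cotangent_lin[OF a] tangent_space_sum) auto
  with insert show ?case by simp
qed (use cotangent_lin[OF a tangent_space_zero tangent_space_zero, of 0 0] in auto)

lemma cotangent_space_lin:
  assumes "a \<in> cotangent_space A x" "b \<in> cotangent_space A x"
  shows "(\<lambda>v. c * a v + d * b v) \<in> cotangent_space A x"
  using assms unfolding cotangent_space_def by (auto simp: algebra_simps)

lemma cotangent_space_zero: "(\<lambda>v. 0) \<in> cotangent_space A x"
  unfolding cotangent_space_def by auto

lemma cotangent_space_sum: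
  assumes "\<And>i. i \<in> I \<Longrightarrow> a i \<in> cotangent_space A x"
  shows "(\<lambda>v. \<Sum>i\<in>I. c i * a i v) \<in> cotangent_space A x"
  using assms
proof (induction I rule: infinite_finite_induct)
  case (insert i I)
  then have "(\<lambda>v. c i * a i v + 1 * (\<Sum>i\<in>I. c i * a i v)) \<in> cotangent_space A x"
    by (intro cotangent_space_lin) auto
  with insert.hyps show ?case by simp
qed (auto intro: cotangent_space_zero)

lemma differential_cotangent: "differential A f x \<in> cotangent_space A x"
  unfolding cotangent_space_def differential_def using tangent_space_lin by auto

lemma differential_const: "differential A (\<lambda>y. c) x = (\<lambda>v. 0)"
  unfolding differential_def using tangent_const by auto

end

section \<open>Coordinate frames\<close>

locale coordinate_chart = atlas_manifold B A
  for B :: "'e::euclidean_space set" and A :: "('m::{t2_space,second_countable_topology}, 'e) atlas" +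
  fixes U :: "'m set" and \<phi> :: "'m \<Rightarrow> 'e"
  assumes chart: "(U, \<phi>) \<in> A"
begin

text \<open>
  The coordinate expression of f, extended to an open set of the whole Euclidean space by making it
  constant along the fibres of the projection onto span B. Its derivative is then unique, and zero
  in the directions orthogonal to span B.
\<close>

definition local_rep :: "('m \<Rightarrow> real) \<Rightarrow> 'e \<Rightarrow> real" where
  "local_rep f = f \<circ> inv_into U \<phi> \<circ> coord_proj B"

text \<open>
  The partial derivative in direction b, extended by 0 to functions that are not smooth near y. It
  is the zero vector for b in Basis outside B.
\<close>

definition coord_vector :: "'e \<Rightarrow> 'm \<Rightarrow> 'm tangent" where
  "coord_vector b y f =
     (if f \<in> smooth_near A y then frechet_derivative (local_rep f) (at (\<phi> y)) b else 0)"

abbreviation coord :: "'e \<Rightarrow> 'm \<Rightarrow> real" where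
  "coord b \<equiv> \<lambda>y. \<phi> y \<bullet> b"

abbreviation dcoord :: "'e \<Rightarrow> 'm \<Rightarrow> 'm cotangent" where
  "dcoord b \<equiv> differential A (coord b)"

lemma openU: "open U" using chart chart_props(1) by blast

lemma coord_proj_chart: "y \<in> U \<Longrightarrow> coord_proj B (\<phi> y) = \<phi> y"
  using coord_proj_id[OF B_Basis] openin_imp_subset[OF chart_props(2)[OF chart]] by blast

lemma local_rep_chart: "y \<in> U \<Longrightarrow> local_rep f (\<phi> y) = f y"
  unfolding local_rep_def using coord_proj_chart inv_into_chart[OF chart] by simp

lemma local_rep_domain:
  assumes "f \<in> smooth_near A x" "x \<in> U"
  obtains W where "open W" "x \<in> W" "W \<subseteq> U" "smooth_fun A W f"
    "open (coord_proj B -` \<phi> ` W)" "\<phi> ` W \<subseteq> coord_proj B -` \<phi> ` W"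
    "smooth_on (local_rep f) (coord_proj B -` \<phi> ` W)"
proof -
  obtain V where V: "open V" "x \<in> V" "smooth_fun A V f"
    using assms(1) unfolding smooth_near_def by blast
  have W: "open (U \<inter> V)" "smooth_fun A (U \<inter> V) f"
    using openU V(1) smooth_fun_subset[OF V(3)] by (auto simp: open_Int)
  have "smooth_on (f \<circ> inv_into U \<phi>) (\<phi> ` (U \<inter> V))"
    using V(3) chart unfolding smooth_fun_def by blast
  then have "smooth_on ((f \<circ> inv_into U \<phi>) \<circ> coord_proj B) (coord_proj B -` \<phi> ` (U \<inter> V))"
    by (rule smooth_on_compose[OF smooth_on_bounded_linear[OF bounded_linear_coord_proj]]) auto
  then have "smooth_on (local_rep f) (coord_proj B -` \<phi> ` (U \<inter> V))"
    unfolding local_rep_def by (simp add: comp_def)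
  moreover have "open (coord_proj B -` \<phi> ` (U \<inter> V))"
    using open_vimage_coord_proj openin_chart_image[OF chart V(1)] by blast
  moreover have "\<phi> ` (U \<inter> V) \<subseteq> coord_proj B -` \<phi> ` (U \<inter> V)"
    using coord_proj_chart by auto
  ultimately show thesis using that[of "U \<inter> V"] W assms(2) V(2) by blast
qed

lemma local_rep_has_derivative:
  assumes "f \<in> smooth_near A x" "x \<in> U"
  shows "(local_rep f has_derivative frechet_derivative (local_rep f) (at (\<phi> x))) (at (\<phi> x))"
proof -
  obtain W where "x \<in> W" and *: "open (coord_proj B -` \<phi> ` W)"
      "\<phi> ` W \<subseteq> coord_proj B -` \<phi> ` W" "smooth_on (local_rep f) (coord_proj B -` \<phi> ` W)"
    using local_rep_domain[OF assms] by metis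
  show ?thesis using smooth_on_open(1)[OF *(1,3), of "\<phi> x"] *(2) \<open>x \<in> W\<close>
    by (auto simp: frechet_derivative_works)
qed

lemma coord_vector_tangent:
  assumes "x \<in> U"
  shows "coord_vector b x \<in> tangent_space A x"
proof (rule tangent_spaceI)
  fix f g assume f: "f \<in> smooth_near A x" and g: "g \<in> smooth_near A x"
  note d = local_rep_has_derivative[OF f assms] local_rep_has_derivative[OF g assms]
  let ?D = "\<lambda>f. frechet_derivative (local_rep f) (at (\<phi> x))"
  show "coord_vector b x (\<lambda>y. c * f y + d * g y) = c * coord_vector b x f + d * coord_vector b x g" for c d
  proof -
    have s: "(\<lambda>y. c * f y + d * g y) \<in> smooth_near A x"
      using f g by (intro smooth_near_add smooth_near_mult smooth_near_const)
    have eq: "local_rep (\<lambda>y. c * f y + d * g y) = (\<lambda>z. c * local_rep f z + d * local_rep g z)"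
      by (auto simp: local_rep_def)
    have der: "((\<lambda>z. c * local_rep f z + d * local_rep g z) has_derivative (\<lambda>v. c * ?D f v + d * ?D g v)) (at (\<phi> x))"
      by (intro has_derivative_add has_derivative_mult_right d)
    have "?D (\<lambda>y. c * f y + d * g y) = (\<lambda>v. c * ?D f v + d * ?D g v)"
      unfolding eq by (rule frechet_derivative_at[OF der, symmetric])
    then show ?thesis using s f g by (simp add: coord_vector_def)
  qed
  show "coord_vector b x (\<lambda>y. f y * g y) = f x * coord_vector b x g + g x * coord_vector b x f"
  proof -
    have eq: "local_rep (\<lambda>y. f y * g y) = (\<lambda>z. local_rep f z * local_rep g z)"
      by (auto simp: local_rep_def)
    have der: "((\<lambda>z. local_rep f z * local_rep g z) has_derivative
        (\<lambda>v. local_rep f (\<phi> x) * ?D g v + ?D f v * local_rep g (\<phi> x))) (at (\<phi> x))"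
      by (intro has_derivative_mult d)
    have "?D (\<lambda>y. f y * g y) = (\<lambda>v. local_rep f (\<phi> x) * ?D g v + ?D f v * local_rep g (\<phi> x))"
      unfolding eq by (rule frechet_derivative_at[OF der, symmetric])
    then show ?thesis using smooth_near_mult[OF f g] f g assms
      by (simp add: coord_vector_def local_rep_chart)
  qed
qed (simp add: coord_vector_def)

lemma coord_vector_smooth:
  assumes "f \<in> smooth_near A x" "x \<in> U"
  shows "(\<lambda>y. coord_vector b y f) \<in> smooth_near A x"
proof -
  obtain W where W: "open W" "x \<in> W" "W \<subseteq> U" "smooth_fun A W f" and
    O: "open (coord_proj B -` \<phi> ` W)" "\<phi> ` W \<subseteq> coord_proj B -` \<phi> ` W"
      "smooth_on (local_rep f) (coord_proj B -` \<phi> ` W)"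
    using local_rep_domain[OF assms] by metis
  have "smooth_on (\<lambda>z. frechet_derivative (local_rep f) (at z) b) (\<phi> ` W)"
    using smooth_on_open(2)[OF O(1,3)] O(2) smooth_on_subset by blast
  then have "smooth_on ((\<lambda>y. coord_vector b y f) \<circ> inv_into U \<phi>) (\<phi> ` W)"
  proof (rule smooth_on_cong_imp)
    fix z assume "z \<in> \<phi> ` W"
    then obtain y where y: "y \<in> W" "z = \<phi> y" by blast
    then have "f \<in> smooth_near A y" using W smooth_fun_imp_near by blast
    then show "frechet_derivative (local_rep f) (at z) b = ((\<lambda>y. coord_vector b y f) \<circ> inv_into U \<phi>) z"
      using y W(3) inv_into_chart[OF chart] by (auto simp: coord_vector_def)
  qed
  then show ?thesis using smooth_near_chartI[OF chart W(1-3)] by blast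
qed

lemma coord_smooth: "x \<in> U \<Longrightarrow> coord b \<in> smooth_near A x"
proof -
  assume x: "x \<in> U"
  have "smooth_on (\<lambda>z::'e. z \<bullet> b) (\<phi> ` U)"
    by (intro smooth_on_bounded_linear bounded_linear_inner_left)
  then have "smooth_on (coord b \<circ> inv_into U \<phi>) (\<phi> ` U)"
    by (rule smooth_on_cong_imp) (auto simp: inv_into_chart[OF chart])
  then show ?thesis using smooth_near_chartI[OF chart openU x] by blast
qed

text \<open>
  By Hadamard's lemma, f is near x the sum of f x and the products (\<phi>_b - \<phi>_b(x)) g_b with g_b(x) the
  b-th partial derivative of f at x. A derivation kills constants, and the product rule leaves only
  the terms v(\<phi>_b) g_b(x), as the first factor of each product vanishes at x.
\<close>

lemma tangent_expand:
  assumes v: "v \<in> tangent_space A x" and x: "x \<in> U"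
  shows "v = (\<lambda>f. \<Sum>b\<in>Basis. v (coord b) * coord_vector b x f)"
proof
  fix f
  show "v f = (\<Sum>b\<in>Basis. v (coord b) * coord_vector b x f)"
  proof (cases "f \<in> smooth_near A x")
    case False
    then show ?thesis using tangent_not_smooth[OF v] by (simp add: coord_vector_def)
  next
    case f: True
    obtain W where W: "open W" "x \<in> W" "W \<subseteq> U" "smooth_fun A W f" and
      O: "open (coord_proj B -` \<phi> ` W)" "\<phi> ` W \<subseteq> coord_proj B -` \<phi> ` W"
        "smooth_on (local_rep f) (coord_proj B -` \<phi> ` W)"
      using local_rep_domain[OF f x] by metis
    have px: "\<phi> x \<in> coord_proj B -` \<phi> ` W" using O(2) W(2) by blast
    obtain r g where r: "r > 0" and gex: "\<forall>b. smooth_on (g b) (ball (\<phi> x) r)"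
      "\<forall>z\<in>ball (\<phi> x) r. local_rep f z = local_rep f (\<phi> x) + (\<Sum>b\<in>Basis. ((z - \<phi> x) \<bullet> b) * g b z)"
      "\<forall>b. g b (\<phi> x) = frechet_derivative (local_rep f) (at (\<phi> x)) b"
      using hadamard[OF O(1) px O(3)] by (elim exE conjE)
    note g = gex(1)[rule_format] gex(2)[rule_format] gex(3)[rule_format]
    have "continuous_on U \<phi>" using chart_props(3)[OF chart] homeomorphism_cont1 by blast
    then have V: "open (U \<inter> \<phi> -` ball (\<phi> x) r)" (is "open ?V")
      using openU by (simp add: continuous_on_open_vimage Int_commute)
    have xV: "x \<in> ?V" using x r by simp
    have gs: "(\<lambda>y. g b (\<phi> y)) \<in> smooth_near A x" for b
    proof (rule smooth_near_chartI[OF chart V xV])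
      have "smooth_on (g b) (\<phi> ` ?V)" using g(1) by (rule smooth_on_subset) auto
      then show "smooth_on ((\<lambda>y. g b (\<phi> y)) \<circ> inv_into U \<phi>) (\<phi> ` ?V)"
        by (rule smooth_on_cong_imp) (auto simp: inv_into_chart[OF chart])
    qed auto
    have ds: "(\<lambda>y. coord b y - coord b x) \<in> smooth_near A x" for b
      by (intro smooth_near_diff coord_smooth x smooth_near_const)
    have ps: "(\<lambda>y. (coord b y - coord b x) * g b (\<phi> y)) \<in> smooth_near A x" for b
      using smooth_near_mult[OF ds gs] .
    have "f y = f x + (\<Sum>b\<in>Basis. (coord b y - coord b x) * g b (\<phi> y))" if "y \<in> ?V" for y
      using g(2)[of "\<phi> y"] that x by (simp add: local_rep_chart inner_diff_left)
    then have "\<forall>\<^sub>F y in nhds x. f y = f x + (\<Sum>b\<in>Basis. (coord b y - coord b x) * g b (\<phi> y))"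
      unfolding eventually_nhds using V xV by blast
    then have "v f = v (\<lambda>y. f x + (\<Sum>b\<in>Basis. (coord b y - coord b x) * g b (\<phi> y)))"
      by (rule tangent_cong[OF v])
    also have "\<dots> = (\<Sum>b\<in>Basis. v (\<lambda>y. (coord b y - coord b x) * g b (\<phi> y)))"
      using ps by (subst tangent_add[OF v]) (auto intro: smooth_near_const smooth_near_sum
          simp: tangent_const[OF v] tangent_sum[OF v])
    also have "\<dots> = (\<Sum>b\<in>Basis. v (coord b) * coord_vector b x f)"
      using f g(3)
      by (intro sum.cong refl, subst tangent_mult[OF v ds gs])
        (simp add: tangent_diff[OF v] coord_smooth[OF x] smooth_near_const tangent_const[OF v] coord_vector_def)
    finally show ?thesis .
  qed
qed

lemma cotangent_expand:
  assumes a: "a \<in> cotangent_space A x" and x: "x \<in> U"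
  shows "a = (\<lambda>v. \<Sum>b\<in>Basis. a (coord_vector b x) * dcoord b x v)"
proof
  fix v
  show "a v = (\<Sum>b\<in>Basis. a (coord_vector b x) * dcoord b x v)"
  proof (cases "v \<in> tangent_space A x")
    case True
    have "a v = a (\<lambda>f. \<Sum>b\<in>Basis. v (coord b) * coord_vector b x f)"
      using tangent_expand[OF True x] by simp
    then show ?thesis using True cotangent_sum[OF a coord_vector_tangent[OF x]]
      by (simp add: differential_def mult.commute)
  next
    case False
    then show ?thesis using cotangent_not_tangent[OF a] by (simp add: differential_def)
  qed
qed

end

section \<open>Vector fields and one-forms\<close>

lemma vector_field_subset: "vector_field A W X \<Longrightarrow> V \<subseteq> W \<Longrightarrow> vector_field A V X"
  unfolding vector_field_def by (fast elim!: smooth_fun_subset)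

lemma vector_field_tangent: "vector_field A W X \<Longrightarrow> x \<in> W \<Longrightarrow> X x \<in> tangent_space A x"
  unfolding vector_field_def by blast

lemma one_form_subset: "one_form A W \<alpha> \<Longrightarrow> V \<subseteq> W \<Longrightarrow> one_form A V \<alpha>"
  unfolding one_form_def by (meson order.trans subsetD)

lemma one_form_cotangent: "one_form A W \<alpha> \<Longrightarrow> x \<in> W \<Longrightarrow> \<alpha> x \<in> cotangent_space A x"
  unfolding one_form_def by blast

context atlas_manifold
begin

lemma vector_field_apply_smooth:
  assumes X: "vector_field A W X" and W: "open W" "x \<in> W" and f: "f \<in> smooth_near A x"
  shows "(\<lambda>y. X y f) \<in> smooth_near A x"
proof -
  obtain U \<phi> where U: "(U, \<phi>) \<in> A" "x \<in> U" using chart_at .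
  interpret coordinate_chart B A U \<phi> by unfold_locales (rule U(1))
  have "open (U \<inter> W)" using openU W(1) by blast
  moreover have "smooth_fun A (U \<inter> W) (\<lambda>y. X y (coord b))" if "b \<in> Basis" for b
    using X U(1) that unfolding vector_field_def by auto
  ultimately have "(\<lambda>y. X y (coord b)) \<in> smooth_near A x" if "b \<in> Basis" for b
    using smooth_fun_imp_near U(2) W(2) that by blast
  then have "(\<lambda>y. \<Sum>b\<in>Basis. X y (coord b) * coord_vector b y f) \<in> smooth_near A x"
    by (intro smooth_near_sum smooth_near_mult coord_vector_smooth f U(2))
  moreover have "(\<Sum>b\<in>Basis. X y (coord b) * coord_vector b y f) = X y f" if "y \<in> U \<inter> W" for y
    using tangent_expand[OF vector_field_tangent[OF X], of y] that by (metis (no_types, lifting) IntE)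
  then have "\<forall>\<^sub>F y in nhds x. (\<Sum>b\<in>Basis. X y (coord b) * coord_vector b y f) = X y f"
    unfolding eventually_nhds using \<open>open (U \<inter> W)\<close> U(2) W(2) by blast
  ultimately show ?thesis by (rule smooth_near_cong)
qed

text \<open>
  The coordinate functions of any chart are smooth near each of its points, so it suffices that the
  field preserves smoothness of germs.
\<close>

lemma vector_fieldI:
  assumes "open W" "\<And>x. x \<in> W \<Longrightarrow> X x \<in> tangent_space A x"
    and "\<And>x f. x \<in> W \<Longrightarrow> f \<in> smooth_near A x \<Longrightarrow> (\<lambda>y. X y f) \<in> smooth_near A x"
  shows "vector_field A W X"
  unfolding vector_field_def
proof (intro conjI ballI, goal_cases)
  case (2 c)
  obtain U \<phi> where c: "c = (U, \<phi>)" by fastforce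
  interpret coordinate_chart B A U \<phi> by unfold_locales (use 2 c in simp)
  have "smooth_fun A (U \<inter> W) (\<lambda>x. X x (coord b))" for b
    using assms(1,3) coord_smooth openU by (intro smooth_funI) auto
  then show ?case using c by simp
qed (rule assms(2))

lemma one_form_apply_smooth:
  assumes \<alpha>: "one_form A W \<alpha>" and W: "open W" "x \<in> W" and X: "vector_field A V X" and V: "open V" "x \<in> V"
  shows "(\<lambda>y. \<alpha> y (X y)) \<in> smooth_near A x"
proof -
  have "open (W \<inter> V)" using W(1) V(1) by blast
  moreover have "vector_field A (W \<inter> V) X" using X vector_field_subset by blast
  ultimately have "smooth_fun A (W \<inter> V) (\<lambda>y. \<alpha> y (X y))"
    using \<alpha> unfolding one_form_def by blast
  then show ?thesis using \<open>open (W \<inter> V)\<close> W(2) V(2) smooth_fun_imp_near by blast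
qed

lemma one_formI:
  assumes "\<And>x. x \<in> W \<Longrightarrow> \<alpha> x \<in> cotangent_space A x"
    and "\<And>x V X. open V \<Longrightarrow> x \<in> V \<Longrightarrow> V \<subseteq> W \<Longrightarrow> vector_field A V X \<Longrightarrow> (\<lambda>y. \<alpha> y (X y)) \<in> smooth_near A x"
  shows "one_form A W \<alpha>"
  unfolding one_form_def using assms by (auto intro!: smooth_funI)

lemma one_form_differential:
  assumes f: "smooth_fun A W f" and W: "open W"
  shows "one_form A W (differential A f)"
proof (rule one_formI)
  fix x V X assume V: "open V" "x \<in> V" "V \<subseteq> W" and X: "vector_field A V X"
  have "(\<lambda>y. X y f) \<in> smooth_near A x"
    using vector_field_apply_smooth[OF X V(1,2)] smooth_fun_imp_near[OF f W] V by blast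
  moreover have "X y f = differential A f y (X y)" if "y \<in> V" for y
    using vector_field_tangent[OF X that] by (simp add: differential_def)
  then have "\<forall>\<^sub>F y in nhds x. X y f = differential A f y (X y)"
    unfolding eventually_nhds using V by blast
  ultimately show "(\<lambda>y. differential A f y (X y)) \<in> smooth_near A x" by (rule smooth_near_cong)
qed (rule differential_cotangent)

lemma lie_bracket_apply:
  "f \<in> smooth_near A x \<Longrightarrow> lie_bracket A X Y x f = X x (\<lambda>y. Y y f) - Y x (\<lambda>y. X y f)"
  by (simp add: lie_bracket_def)

lemma vector_field_mult_eventually:
  assumes X: "vector_field A W X" "open W" "x \<in> W" and f: "f \<in> smooth_near A x" and g: "g \<in> smooth_near A x"
  shows "\<forall>\<^sub>F y in nhds x. X y (\<lambda>z. f z * g z) = f y * X y g + g y * X y f"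
proof -
  have "\<forall>\<^sub>F y in nhds x. y \<in> W" using X(2,3) eventually_nhds by blast
  then show ?thesis using smooth_near_eventually[OF f] smooth_near_eventually[OF g]
    by eventually_elim (rule tangent_mult[OF vector_field_tangent[OF X(1)]])
qed

lemma vector_field_lin_eventually:
  assumes X: "vector_field A W X" "open W" "x \<in> W" and f: "f \<in> smooth_near A x" and g: "g \<in> smooth_near A x"
  shows "\<forall>\<^sub>F y in nhds x. X y (\<lambda>z. c * f z + d * g z) = c * X y f + d * X y g"
proof -
  have "\<forall>\<^sub>F y in nhds x. y \<in> W" using X(2,3) eventually_nhds by blast
  then show ?thesis using smooth_near_eventually[OF f] smooth_near_eventually[OF g]
    by eventually_elim (rule tangent_lin[OF vector_field_tangent[OF X(1)]])
qed

text \<open>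
  The cross terms X f * Y g + X g * Y f of the product rule are symmetric in X and Y and cancel.
\<close>

lemma lie_bracket_tangent:
  assumes X: "vector_field A W X" "open W" "x \<in> W" and Y: "vector_field A V Y" "open V" "x \<in> V"
  shows "lie_bracket A X Y x \<in> tangent_space A x"
proof (rule tangent_spaceI)
  have tX: "X x \<in> tangent_space A x" and tY: "Y x \<in> tangent_space A x"
    using X Y vector_field_tangent by blast+
  fix f g assume f: "f \<in> smooth_near A x" and g: "g \<in> smooth_near A x"
  note s = vector_field_apply_smooth[OF X] vector_field_apply_smooth[OF Y]
  note sm = s[OF f] s[OF g]
  show "lie_bracket A X Y x (\<lambda>y. c * f y + d * g y) = c * lie_bracket A X Y x f + d * lie_bracket A X Y x g" for c d
  proof -
    have "(\<lambda>y. c * f y + d * g y) \<in> smooth_near A x"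
      using f g by (intro smooth_near_add smooth_near_mult smooth_near_const)
    then show ?thesis
      using f g tangent_cong[OF tX vector_field_lin_eventually[OF Y f g, of c d]]
        tangent_cong[OF tY vector_field_lin_eventually[OF X f g, of c d]]
      by (simp add: lie_bracket_apply tangent_lin[OF tX] tangent_lin[OF tY] sm algebra_simps)
  qed
  show "lie_bracket A X Y x (\<lambda>y. f y * g y) = f x * lie_bracket A X Y x g + g x * lie_bracket A X Y x f"
    using smooth_near_mult[OF f g] f g tangent_cong[OF tX vector_field_mult_eventually[OF Y f g]]
      tangent_cong[OF tY vector_field_mult_eventually[OF X f g]]
    by (simp add: lie_bracket_apply tangent_add[OF tX] tangent_add[OF tY] tangent_mult[OF tX] tangent_mult[OF tY]
        smooth_near_mult sm algebra_simps)
qed (simp add: lie_bracket_def)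

end

context coordinate_chart
begin

lemma vector_field_coord_vector: "vector_field A U (coord_vector b)"
  by (rule vector_fieldI[OF openU coord_vector_tangent coord_vector_smooth])

lemma vector_field_extension:
  "vector_field A U (\<lambda>y f. \<Sum>b\<in>Basis. c b * coord_vector b y f)"
  by (rule vector_fieldI[OF openU])
    (auto intro!: tangent_space_sum coord_vector_tangent smooth_near_sum smooth_near_mult
      smooth_near_const coord_vector_smooth)

lemma smooth_fun_coord: "smooth_fun A U (coord b)"
  using coord_smooth openU by (intro smooth_funI)

lemma one_form_dcoord: "one_form A U (dcoord b)"
  by (rule one_form_differential[OF smooth_fun_coord openU])

lemma one_form_extension:
  "one_form A U (\<lambda>y v. \<Sum>b\<in>Basis. c b * dcoord b y v)"
proof (rule one_formI)
  fix x V X assume "open V" "x \<in> V" "V \<subseteq> U" "vector_field A V X"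
  then show "(\<lambda>y. \<Sum>b\<in>Basis. c b * dcoord b y (X y)) \<in> smooth_near A x"
    by (intro smooth_near_sum smooth_near_mult smooth_near_const
        one_form_apply_smooth[OF one_form_dcoord openU]) auto
qed (intro cotangent_space_sum differential_cotangent)

end

section \<open>Lie derivative of one-forms\<close>

locale manifold_with_field = atlas_manifold B A
  for B :: "'e::euclidean_space set" and A :: "('m::{t2_space,second_countable_topology}, 'e) atlas" +
  fixes Z :: "'m \<Rightarrow> 'm tangent"
  assumes field: "vector_field A UNIV Z"
begin

lemma Z_tangent: "Z x \<in> tangent_space A x"
  using field vector_field_tangent by blast

lemma Z_smooth: "f \<in> smooth_near A x \<Longrightarrow> (\<lambda>y. Z y f) \<in> smooth_near A x"
  using vector_field_apply_smooth[OF field] by simp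

end

locale chart_with_field = manifold_with_field B A Z + coordinate_chart B A U \<phi>
  for B :: "'e::euclidean_space set" and A :: "('m::{t2_space,second_countable_topology}, 'e) atlas"
    and Z U \<phi>
begin

text \<open>
  Write X as the sum of the X(\<phi>_b) times the coordinate vectors. The terms with Z(X(\<phi>_b)) occur both
  in Z(\<alpha>(X)) and in \<alpha>([Z, X]) and cancel. The remaining expression contains X only through its value
  at x.
\<close>

lemma lie_one_form_tensorial:
  assumes x: "x \<in> U" and \<alpha>: "one_form A W \<alpha>" "open W" "x \<in> W"
    and X: "vector_field A V X" "open V" "x \<in> V"
  shows "Z x (\<lambda>y. \<alpha> y (X y)) - \<alpha> x (lie_bracket A Z X x) =
    (\<Sum>b\<in>Basis. Z x (\<lambda>y. \<alpha> y (coord_vector b y)) * X x (coord b) +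
       \<alpha> x (coord_vector b x) * X x (\<lambda>y. Z y (coord b)))"
proof -
  note cs = coord_smooth[OF x]
  have cot: "\<alpha> y \<in> cotangent_space A y" if "y \<in> W" for y
    using \<alpha>(1) that one_form_cotangent by blast
  have Xs: "(\<lambda>y. X y (coord b)) \<in> smooth_near A x" for b
    by (rule vector_field_apply_smooth[OF X cs])
  have \<alpha>s: "(\<lambda>y. \<alpha> y (coord_vector b y)) \<in> smooth_near A x" for b
    by (rule one_form_apply_smooth[OF \<alpha> vector_field_coord_vector openU x])
  have "\<alpha> y (X y) = (\<Sum>b\<in>Basis. X y (coord b) * \<alpha> y (coord_vector b y))" if "y \<in> U \<inter> W \<inter> V" for y
  proof -
    have "X y = (\<lambda>f. \<Sum>b\<in>Basis. X y (coord b) * coord_vector b y f)"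
      using tangent_expand[OF vector_field_tangent[OF X(1)]] that by blast
    then have "\<alpha> y (X y) = \<alpha> y (\<lambda>f. \<Sum>b\<in>Basis. X y (coord b) * coord_vector b y f)"
      by simp
    also have "\<dots> = (\<Sum>b\<in>Basis. X y (coord b) * \<alpha> y (coord_vector b y))"
      by (rule cotangent_sum[OF cot coord_vector_tangent]) (use that in auto)
    finally show ?thesis .
  qed
  moreover have "open (U \<inter> W \<inter> V)" using openU \<alpha> X by blast
  ultimately have "\<forall>\<^sub>F y in nhds x. \<alpha> y (X y) = (\<Sum>b\<in>Basis. X y (coord b) * \<alpha> y (coord_vector b y))"
    unfolding eventually_nhds using x \<alpha>(3) X(3) by blast
  then have "Z x (\<lambda>y. \<alpha> y (X y)) = Z x (\<lambda>y. \<Sum>b\<in>Basis. X y (coord b) * \<alpha> y (coord_vector b y))"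
    by (rule tangent_cong[OF Z_tangent])
  also have "\<dots> = (\<Sum>b\<in>Basis. X x (coord b) * Z x (\<lambda>y. \<alpha> y (coord_vector b y)) +
      \<alpha> x (coord_vector b x) * Z x (\<lambda>y. X y (coord b)))"
    by (simp add: tangent_sum[OF Z_tangent smooth_near_mult[OF Xs \<alpha>s]] tangent_mult[OF Z_tangent Xs \<alpha>s])
  finally have 1: "Z x (\<lambda>y. \<alpha> y (X y)) = \<dots>" .
  have "lie_bracket A Z X x \<in> tangent_space A x"
    by (rule lie_bracket_tangent[OF field _ _ X]) auto
  from tangent_expand[OF this x]
  have "\<alpha> x (lie_bracket A Z X x) = \<alpha> x (\<lambda>f. \<Sum>b\<in>Basis. lie_bracket A Z X x (coord b) * coord_vector b x f)"
    by simp
  also have "\<dots> = (\<Sum>b\<in>Basis. (Z x (\<lambda>y. X y (coord b)) - X x (\<lambda>y. Z y (coord b))) * \<alpha> x (coord_vector b x))"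
    by (simp add: cotangent_sum[OF cot[OF \<alpha>(3)] coord_vector_tangent[OF x]] lie_bracket_apply cs)
  finally show ?thesis unfolding 1 by (simp add: sum_subtractf[symmetric] algebra_simps)
qed

lemma lie_one_form_apply:
  assumes x: "x \<in> U" and \<alpha>: "one_form A W \<alpha>" "open W" "x \<in> W"
    and X: "vector_field A V X" "open V" "x \<in> V"
  shows "lie_one_form A Z \<alpha> x (X x) = Z x (\<lambda>y. \<alpha> y (X y)) - \<alpha> x (lie_bracket A Z X x)"
proof -
  have "X x \<in> tangent_space A x" using X vector_field_tangent by blast
  moreover have "(THE r. \<forall>W Y. open W \<and> x \<in> W \<and> vector_field A W Y \<and> Y x = X x \<longrightarrow>
      r = Z x (\<lambda>y. \<alpha> y (Y y)) - \<alpha> x (lie_bracket A Z Y x)) =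
      Z x (\<lambda>y. \<alpha> y (X y)) - \<alpha> x (lie_bracket A Z X x)"
  proof (rule the_equality)
    show "\<forall>W Y. open W \<and> x \<in> W \<and> vector_field A W Y \<and> Y x = X x \<longrightarrow>
      Z x (\<lambda>y. \<alpha> y (X y)) - \<alpha> x (lie_bracket A Z X x) = Z x (\<lambda>y. \<alpha> y (Y y)) - \<alpha> x (lie_bracket A Z Y x)"
    proof (intro allI impI, elim conjE)
      fix W Y assume "open W" "x \<in> W" "vector_field A W Y" "Y x = X x"
      then show "Z x (\<lambda>y. \<alpha> y (X y)) - \<alpha> x (lie_bracket A Z X x) = Z x (\<lambda>y. \<alpha> y (Y y)) - \<alpha> x (lie_bracket A Z Y x)"
        using lie_one_form_tensorial[OF x \<alpha> X] lie_one_form_tensorial[OF x \<alpha>, of W Y] by simp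
    qed
  qed (use X in blast)
  ultimately show ?thesis by (simp add: lie_one_form_def)
qed

lemma vector_extension_at:
  assumes "v \<in> tangent_space A x" "x \<in> U"
  obtains X where "vector_field A U X" "X x = v"
  using that[OF vector_field_extension] tangent_expand[OF assms] by metis

text \<open>
  The value that \<open>lie_one_form_tensorial\<close> gives on a tangent vector v is linear in v, which exhibits
  the Lie derivative as a combination of the covectors d\<phi>_b and d(Z \<phi>_b).
\<close>

lemma lie_one_form_components:
  assumes x: "x \<in> U" and \<alpha>: "one_form A W \<alpha>" "open W" "x \<in> W"
  shows "lie_one_form A Z \<alpha> x = (\<lambda>v. \<Sum>b\<in>Basis. Z x (\<lambda>y. \<alpha> y (coord_vector b y)) * dcoord b x v +
       \<alpha> x (coord_vector b x) * differential A (\<lambda>y. Z y (coord b)) x v)"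
proof
  fix v
  show "lie_one_form A Z \<alpha> x v = (\<Sum>b\<in>Basis. Z x (\<lambda>y. \<alpha> y (coord_vector b y)) * dcoord b x v +
       \<alpha> x (coord_vector b x) * differential A (\<lambda>y. Z y (coord b)) x v)"
  proof (cases "v \<in> tangent_space A x")
    case True
    then obtain X where X: "vector_field A U X" "X x = v" using x vector_extension_at by blast
    show ?thesis using lie_one_form_apply[OF x \<alpha> X(1) openU x] lie_one_form_tensorial[OF x \<alpha> X(1) openU x]
      True unfolding X(2) by (simp add: differential_def)
  qed (simp add: differential_def lie_one_form_def)
qed

lemma lie_one_form_cotangent:
  assumes x: "x \<in> U" and \<alpha>: "one_form A W \<alpha>" "open W" "x \<in> W"
  shows "lie_one_form A Z \<alpha> x \<in> cotangent_space A x"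
proof -
  have "(\<lambda>v. \<Sum>b\<in>Basis. Z x (\<lambda>y. \<alpha> y (coord_vector b y)) * dcoord b x v) \<in> cotangent_space A x"
    "(\<lambda>v. \<Sum>b\<in>Basis. \<alpha> x (coord_vector b x) * differential A (\<lambda>y. Z y (coord b)) x v) \<in> cotangent_space A x"
    by (intro cotangent_space_sum differential_cotangent)+
  from cotangent_space_lin[OF this, of 1 1] show ?thesis
    unfolding lie_one_form_components[OF assms] by (simp add: sum.distrib)
qed

end

context manifold_with_field
begin

text \<open>
  For every extension X of the tangent vector, Z(X f) - [Z, X] f = X(Z f) by the definition of the
  bracket.
\<close>

lemma lie_one_form_differential:
  assumes f: "smooth_fun A W f" "open W" "x \<in> W"
  shows "lie_one_form A Z (differential A f) x = differential A (\<lambda>y. Z y f) x"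
proof
  fix v
  obtain U \<phi> where U: "(U, \<phi>) \<in> A" "x \<in> U" using chart_at .
  interpret chart_with_field B A Z U \<phi> by unfold_locales (rule U(1))
  show "lie_one_form A Z (differential A f) x v = differential A (\<lambda>y. Z y f) x v"
  proof (cases "v \<in> tangent_space A x")
    case True
    then obtain X where X: "vector_field A U X" "X x = v" using U(2) vector_extension_at by blast
    have fx: "f \<in> smooth_near A x" using f smooth_fun_imp_near by blast
    have "differential A f y (X y) = X y f" if "y \<in> U" for y
      using vector_field_tangent[OF X(1) that] by (simp add: differential_def)
    then have "\<forall>\<^sub>F y in nhds x. differential A f y (X y) = X y f"
      unfolding eventually_nhds using openU U(2) by blast
    then have "Z x (\<lambda>y. differential A f y (X y)) = Z x (\<lambda>y. X y f)"
      by (rule tangent_cong[OF Z_tangent])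
    moreover have "lie_bracket A Z X x \<in> tangent_space A x"
      by (rule lie_bracket_tangent[OF field _ _ X(1) openU U(2)]) auto
    then have "differential A f x (lie_bracket A Z X x) = Z x (\<lambda>y. X y f) - X x (\<lambda>y. Z y f)"
      by (simp add: differential_def lie_bracket_apply fx)
    ultimately show ?thesis
      using lie_one_form_apply[OF U(2) one_form_differential[OF f(1,2)] f(2,3) X(1) openU U(2)] True
      unfolding X(2) by (simp add: differential_def)
  qed (simp add: differential_def lie_one_form_def)
qed

end

section \<open>Multilinear expansions\<close>

lemma alternating_lin:
  assumes "F \<in> alternating_forms k W lc" "length ws = k" "set ws \<subseteq> W" "i < k" "a \<in> W" "b \<in> W"
  shows "F (ws[i := lc c a d b]) = c * F (ws[i := a]) + d * F (ws[i := b])"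
  using assms unfolding alternating_forms_def by blast

lemma alternating_repeated:
  assumes "F \<in> alternating_forms k W lc" "length ws = k" "set ws \<subseteq> W" "i < j" "j < k" "ws ! i = ws ! j"
  shows "F ws = 0"
  using assms unfolding alternating_forms_def by blast

lemma alternating_outside:
  assumes "F \<in> alternating_forms k W lc" "\<not> (length ws = k \<and> set ws \<subseteq> W)"
  shows "F ws = 0"
  using assms unfolding alternating_forms_def by blast

lemma multivector_alternating:
  "P \<in> multivector_fields A k \<Longrightarrow> P x \<in> alternating_forms k (cotangent_space A x) cotangent_lc"
  unfolding multivector_fields_def by blast

lemma set_update_subset: "set ws \<subseteq> W \<Longrightarrow> a \<in> W \<Longrightarrow> set (ws[i := a]) \<subseteq> W"
  using set_update_subset_insert[of ws i a] by blast

lemma one_forms_cotangent: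
  "\<forall>\<alpha>\<in>set \<alpha>s. one_form A W \<alpha> \<Longrightarrow> x \<in> W \<Longrightarrow> set (map (\<lambda>\<alpha>. \<alpha> x) \<alpha>s) \<subseteq> cotangent_space A x"
  unfolding one_form_def by auto

context atlas_manifold
begin

lemma alternating_zero_slot:
  assumes F: "F \<in> alternating_forms k (cotangent_space A x) cotangent_lc"
    and i: "i < length as" "as ! i = (\<lambda>v. 0)"
  shows "F as = 0"
proof (cases "length as = k \<and> set as \<subseteq> cotangent_space A x")
  case True
  have "F (as[i := cotangent_lc 0 (\<lambda>v. 0) 0 (\<lambda>v. 0)]) = 0"
    using alternating_lin[OF F, of as i "\<lambda>v. 0" "\<lambda>v. 0" 0 0] True i cotangent_space_zero by auto
  moreover have "as[i := cotangent_lc 0 (\<lambda>v. 0) 0 (\<lambda>v. 0)] = as"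
    using i by (simp add: cotangent_lc_def list_update_same_conv)
  ultimately show ?thesis by simp
qed (rule alternating_outside[OF F])

lemma alternating_sum:
  assumes F: "F \<in> alternating_forms k (cotangent_space A x) cotangent_lc"
    and as: "length as = k" "set as \<subseteq> cotangent_space A x" "i < k"
    and a: "\<And>j. j \<in> J \<Longrightarrow> a j \<in> cotangent_space A x"
  shows "F (as[i := (\<lambda>v. \<Sum>j\<in>J. c j * a j v)]) = (\<Sum>j\<in>J. c j * F (as[i := a j]))"
  using a
proof (induction J rule: infinite_finite_induct)
  case (insert j J)
  have "F (as[i := cotangent_lc (c j) (a j) 1 (\<lambda>v. \<Sum>j\<in>J. c j * a j v)]) =
      c j * F (as[i := a j]) + 1 * F (as[i := (\<lambda>v. \<Sum>j\<in>J. c j * a j v)])"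
    using insert.prems by (intro alternating_lin[OF F as] cotangent_space_sum) auto
  with insert show ?case by (simp add: cotangent_lc_def)
qed (use alternating_zero_slot[OF F] as in auto)

end

context coordinate_chart
begin

lemma alternating_expand:
  assumes F: "F \<in> alternating_forms k (cotangent_space A x) cotangent_lc" and x: "x \<in> U"
    and as: "length as = k" "set as \<subseteq> cotangent_space A x" "i < k"
  shows "F as = (\<Sum>b\<in>Basis. (as ! i) (coord_vector b x) * F (as[i := dcoord b x]))"
proof -
  have "as ! i \<in> cotangent_space A x" using as by auto
  from cotangent_expand[OF this x]
  have "as[i := (\<lambda>v. \<Sum>b\<in>Basis. (as ! i) (coord_vector b x) * dcoord b x v)] = as"
    by (metis list_update_id)
  then have "F as = F (as[i := (\<lambda>v. \<Sum>b\<in>Basis. (as ! i) (coord_vector b x) * dcoord b x v)])"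
    by simp
  then show ?thesis by (simp add: alternating_sum[OF F as differential_cotangent])
qed

lemma multivector_expand:
  assumes P: "P \<in> multivector_fields A k" and \<alpha>s: "length \<alpha>s = k" "\<forall>\<alpha>\<in>set \<alpha>s. one_form A W \<alpha>"
    and "i < k" "y \<in> U" "y \<in> W"
  shows "P y (map (\<lambda>\<alpha>. \<alpha> y) \<alpha>s) =
    (\<Sum>b\<in>Basis. (\<alpha>s ! i) y (coord_vector b y) * P y (map (\<lambda>\<alpha>. \<alpha> y) (\<alpha>s[i := dcoord b])))"
proof -
  have "set (map (\<lambda>\<alpha>. \<alpha> y) \<alpha>s) \<subseteq> cotangent_space A y"
    by (rule one_forms_cotangent[OF \<alpha>s(2) assms(6)])
  then show ?thesis
    using alternating_expand[OF multivector_alternating[OF P] assms(5), of "map (\<lambda>\<alpha>. \<alpha> y) \<alpha>s" i] \<alpha>s(1) assms(4)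
    by (simp add: map_update)
qed

lemma multivector_dcoords_smooth:
  assumes P: "P \<in> multivector_fields A k" and bs: "length bs = k" "set bs \<subseteq> Basis" and x: "x \<in> U"
  shows "(\<lambda>y. P y (map (\<lambda>b. dcoord b y) bs)) \<in> smooth_near A x"
proof -
  have "smooth_fun A U (\<lambda>y. P y (map (\<lambda>b. dcoord b y) bs))"
    using P chart bs unfolding multivector_fields_def by blast
  then show ?thesis using openU x smooth_fun_imp_near by blast
qed

text \<open>
  Induction on the number m of leading arguments that are not yet coordinate differentials. Expanding
  the last of them reduces m by one; for m = 0 the claim is part of the definition of a smooth
  multivector field.
\<close>

lemma multivector_apply_smooth_aux:
  assumes P: "P \<in> multivector_fields A k" and W: "open W" "x \<in> W" "W \<subseteq> U"
  shows "length \<alpha>s = k \<Longrightarrow> \<forall>\<alpha>\<in>set \<alpha>s. one_form A W \<alpha> \<Longrightarrow> m \<le> k \<Longrightarrow>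
    (\<forall>i<k. m \<le> i \<longrightarrow> \<alpha>s ! i \<in> dcoord ` Basis) \<Longrightarrow>
    (\<lambda>y. P y (map (\<lambda>\<alpha>. \<alpha> y) \<alpha>s)) \<in> smooth_near A x"
proof (induction m arbitrary: \<alpha>s)
  case 0
  then have "\<forall>\<alpha>\<in>set \<alpha>s. \<alpha> \<in> dcoord ` Basis" by (metis in_set_conv_nth le0)
  then have "\<exists>bs. set bs \<subseteq> Basis \<and> \<alpha>s = map dcoord bs" 
  proof (induction \<alpha>s)
    case (Cons \<alpha> \<alpha>s)
    then obtain bs b where "set bs \<subseteq> Basis" "\<alpha>s = map dcoord bs" "b \<in> Basis" "\<alpha> = dcoord b" by auto
    then show ?case by (intro exI[of _ "b # bs"]) auto
  qed simp
  then obtain bs where bs: "set bs \<subseteq> Basis" "\<alpha>s = map dcoord bs" by blast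
  then have "(\<lambda>y. P y (map (\<lambda>\<alpha>. \<alpha> y) \<alpha>s)) = (\<lambda>y. P y (map (\<lambda>b. dcoord b y) bs))"
    by (simp add: comp_def)
  then show ?case using multivector_dcoords_smooth[OF P _ bs(1), of x] W bs(2) 0(1) by auto
next
  case (Suc m)
  have m: "m < k" using Suc.prems by simp
  have am: "one_form A W (\<alpha>s ! m)" using Suc.prems m by simp
  have "(\<lambda>y. P y (map (\<lambda>\<alpha>. \<alpha> y) (\<alpha>s[m := dcoord b]))) \<in> smooth_near A x" if b: "b \<in> Basis" for b
  proof (rule Suc.IH)
    show "\<forall>\<alpha>\<in>set (\<alpha>s[m := dcoord b]). one_form A W \<alpha>"
      using Suc.prems(2) one_form_subset[OF one_form_dcoord W(3)] set_update_subset_insert by fastforce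
    show "\<forall>i<k. m \<le> i \<longrightarrow> \<alpha>s[m := dcoord b] ! i \<in> dcoord ` Basis"
      using Suc.prems b by (auto simp: nth_list_update)
  qed (use Suc.prems in auto)
  moreover have "(\<lambda>y. (\<alpha>s ! m) y (coord_vector b y)) \<in> smooth_near A x" for b
    by (rule one_form_apply_smooth[OF am W(1,2) vector_field_coord_vector openU]) (use W in auto)
  ultimately have "(\<lambda>y. \<Sum>b\<in>Basis. (\<alpha>s ! m) y (coord_vector b y) *
      P y (map (\<lambda>\<alpha>. \<alpha> y) (\<alpha>s[m := dcoord b]))) \<in> smooth_near A x"
    by (intro smooth_near_sum smooth_near_mult) auto
  moreover have "\<forall>\<^sub>F y in nhds x. (\<Sum>b\<in>Basis. (\<alpha>s ! m) y (coord_vector b y) *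
      P y (map (\<lambda>\<alpha>. \<alpha> y) (\<alpha>s[m := dcoord b]))) = P y (map (\<lambda>\<alpha>. \<alpha> y) \<alpha>s)"
    unfolding eventually_nhds
    using multivector_expand[OF P Suc.prems(1,2) m] W by (intro exI[of _ W]) auto
  ultimately show ?case by (rule smooth_near_cong)
qed

end

context atlas_manifold
begin

lemma multivector_apply_smooth:
  assumes P: "P \<in> multivector_fields A k" and \<alpha>s: "length \<alpha>s = k" "\<forall>\<alpha>\<in>set \<alpha>s. one_form A W \<alpha>"
    and W: "open W" "x \<in> W"
  shows "(\<lambda>y. P y (map (\<lambda>\<alpha>. \<alpha> y) \<alpha>s)) \<in> smooth_near A x"
proof -
  obtain U \<phi> where U: "(U, \<phi>) \<in> A" "x \<in> U" using chart_at .
  interpret coordinate_chart B A U \<phi> by unfold_locales (rule U(1))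
  have "\<forall>\<alpha>\<in>set \<alpha>s. one_form A (U \<inter> W) \<alpha>" using \<alpha>s(2) one_form_subset by blast
  moreover have "open (U \<inter> W)" using W(1) openU by blast
  ultimately show ?thesis
    using multivector_apply_smooth_aux[OF P _ _ _ \<alpha>s(1), of "U \<inter> W" x k] U(2) W(2) by auto
qed

end

section \<open>Lie derivative of multivector fields\<close>

text \<open>
  The part of the derivative of a contraction of P with one-forms that is not accounted for by the Lie
  derivatives of the forms, and hence is attributed to P. That it depends only on the values of the
  forms at x is the content of \<open>leibniz_defect_tensorial\<close>.
\<close>

definition leibniz_defect ::
    "('m::topological_space, 'e::euclidean_space) atlas \<Rightarrow> ('m \<Rightarrow> 'm tangent) \<Rightarrow>
      ('m \<Rightarrow> 'm multivector) \<Rightarrow> ('m \<Rightarrow> 'm cotangent) list \<Rightarrow> 'm \<Rightarrow> real" where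
  "leibniz_defect A Z P \<alpha>s x = Z x (\<lambda>y. P y (map (\<lambda>\<alpha>. \<alpha> y) \<alpha>s)) -
     (\<Sum>i<length \<alpha>s. P x ((map (\<lambda>\<alpha>. \<alpha> x) \<alpha>s)[i := lie_one_form A Z (\<alpha>s ! i) x]))"

context chart_with_field
begin

lemma lie_one_form_dcoord:
  "x \<in> U \<Longrightarrow> lie_one_form A Z (dcoord b) x = differential A (\<lambda>y. Z y (coord b)) x"
  by (rule lie_one_form_differential[OF smooth_fun_coord openU])

text \<open>
  Near x write the i-th form as the sum of c_b d\<phi>_b. Applying Z to P(...) produces, besides the
  expected terms, the sum of Z(c_b) P(..., d\<phi>_b, ...). The i-th Lie derivative contains
  Z(c_b) d\<phi>_b as well, by \<open>lie_one_form_components\<close>, and the two contributions cancel.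
\<close>

lemma leibniz_defect_expand:
  assumes P: "P \<in> multivector_fields A k" and \<alpha>s: "length \<alpha>s = k" "\<forall>\<alpha>\<in>set \<alpha>s. one_form A W \<alpha>"
    and W: "open W" "x \<in> W" and x: "x \<in> U" and i: "i < k"
  shows "leibniz_defect A Z P \<alpha>s x =
    (\<Sum>b\<in>Basis. (\<alpha>s ! i) x (coord_vector b x) * leibniz_defect A Z P (\<alpha>s[i := dcoord b]) x)"
proof -
  let ?c = "\<lambda>b y. (\<alpha>s ! i) y (coord_vector b y)"
  let ?ev = "\<lambda>\<alpha>s y. map (\<lambda>\<alpha>. \<alpha> y) \<alpha>s"
  let ?as = "?ev \<alpha>s x"
  let ?L = "\<lambda>\<alpha>. lie_one_form A Z \<alpha> x"
  have ai: "one_form A W (\<alpha>s ! i)" using \<alpha>s i by simp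
  have as: "set ?as \<subseteq> cotangent_space A x" by (rule one_forms_cotangent[OF \<alpha>s(2) W(2)])
  have L: "?L (\<alpha>s ! j) \<in> cotangent_space A x" if "j < k" for j
    using \<alpha>s that by (intro lie_one_form_cotangent[OF x _ W]) auto
  note PA = multivector_alternating[OF P, of x]
  have cs: "?c b \<in> smooth_near A x" for b
    by (rule one_form_apply_smooth[OF ai W vector_field_coord_vector openU x])
  have Ps: "(\<lambda>y. P y (?ev (\<alpha>s[i := dcoord b]) y)) \<in> smooth_near A x" for b
  proof (rule multivector_apply_smooth[OF P])
    have "\<forall>\<alpha>\<in>set \<alpha>s. one_form A (U \<inter> W) \<alpha>" "one_form A (U \<inter> W) (dcoord b)"
      using \<alpha>s(2) one_form_dcoord by (blast intro: one_form_subset)+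
    then show "\<forall>\<alpha>\<in>set (\<alpha>s[i := dcoord b]). one_form A (U \<inter> W) \<alpha>"
      using set_update_subset_insert[of \<alpha>s i "dcoord b"] by blast
    show "open (U \<inter> W)" using openU W by blast
  qed (use \<alpha>s x W in auto)
  have "\<forall>\<^sub>F y in nhds x. P y (?ev \<alpha>s y) = (\<Sum>b\<in>Basis. ?c b y * P y (?ev (\<alpha>s[i := dcoord b]) y))"
    unfolding eventually_nhds using multivector_expand[OF P \<alpha>s i] openU W x
    by (intro exI[of _ "U \<inter> W"]) auto
  then have "Z x (\<lambda>y. P y (?ev \<alpha>s y)) = Z x (\<lambda>y. \<Sum>b\<in>Basis. ?c b y * P y (?ev (\<alpha>s[i := dcoord b]) y))"
    by (rule tangent_cong[OF Z_tangent])
  also have "\<dots> = (\<Sum>b\<in>Basis. ?c b x * Z x (\<lambda>y. P y (?ev (\<alpha>s[i := dcoord b]) y)) +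
      P x (?ev (\<alpha>s[i := dcoord b]) x) * Z x (?c b))"
    by (simp add: tangent_sum[OF Z_tangent smooth_near_mult[OF cs Ps]] tangent_mult[OF Z_tangent cs Ps])
  finally have 1: "Z x (\<lambda>y. P y (?ev \<alpha>s y)) = (\<Sum>b\<in>Basis. ?c b x * Z x (\<lambda>y. P y (?ev (\<alpha>s[i := dcoord b]) y))) +
      (\<Sum>b\<in>Basis. Z x (?c b) * P x (?ev (\<alpha>s[i := dcoord b]) x))"
    by (simp add: sum.distrib mult.commute)
  \<comment> \<open>For j distinct from i the i-th entry is still available for expansion after the j-th one has
     been replaced by its Lie derivative.\<close>
  have 2: "P x (?as[j := ?L (\<alpha>s ! j)]) =
      (\<Sum>b\<in>Basis. ?c b x * P x ((?ev (\<alpha>s[i := dcoord b]) x)[j := ?L (\<alpha>s[i := dcoord b] ! j)]))"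
    if j: "j < k" "j \<noteq> i" for j
    using alternating_expand[OF PA x, of "?as[j := ?L (\<alpha>s ! j)]" i] \<alpha>s(1) set_update_subset[OF as L] i j
    by (simp add: map_update list_update_swap)
  have 3: "P x (?as[i := ?L (\<alpha>s ! i)]) = (\<Sum>b\<in>Basis. Z x (?c b) * P x (?ev (\<alpha>s[i := dcoord b]) x)) +
      (\<Sum>b\<in>Basis. ?c b x * P x ((?ev (\<alpha>s[i := dcoord b]) x)[i := ?L (\<alpha>s[i := dcoord b] ! i)]))"
  proof -
    let ?u = "\<lambda>v. \<Sum>b\<in>Basis. Z x (?c b) * dcoord b x v"
    let ?w = "\<lambda>v. \<Sum>b\<in>Basis. ?c b x * differential A (\<lambda>y. Z y (coord b)) x v"
    have "?L (\<alpha>s ! i) = cotangent_lc 1 ?u 1 ?w"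
      unfolding lie_one_form_components[OF x ai W] cotangent_lc_def by (simp add: sum.distrib)
    moreover have "?u \<in> cotangent_space A x" "?w \<in> cotangent_space A x"
      by (intro cotangent_space_sum differential_cotangent)+
    ultimately have "P x (?as[i := ?L (\<alpha>s ! i)]) = 1 * P x (?as[i := ?u]) + 1 * P x (?as[i := ?w])"
      using alternating_lin[OF PA _ as i] \<alpha>s(1) by simp
    also have "P x (?as[i := ?u]) = (\<Sum>b\<in>Basis. Z x (?c b) * P x (?as[i := dcoord b x]))"
      using \<alpha>s(1) by (intro alternating_sum[OF PA _ as i] differential_cotangent) simp
    also have "P x (?as[i := ?w]) = (\<Sum>b\<in>Basis. ?c b x * P x (?as[i := differential A (\<lambda>y. Z y (coord b)) x]))"
      using \<alpha>s(1) by (intro alternating_sum[OF PA _ as i] differential_cotangent) simp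
    finally show ?thesis using i \<alpha>s(1) by (simp add: map_update lie_one_form_dcoord[OF x])
  qed
  have "leibniz_defect A Z P \<alpha>s x = Z x (\<lambda>y. P y (?ev \<alpha>s y)) -
      (P x (?as[i := ?L (\<alpha>s ! i)]) + (\<Sum>j\<in>{..<k} - {i}. P x (?as[j := ?L (\<alpha>s ! j)])))"
    unfolding leibniz_defect_def \<alpha>s(1) using i by (subst sum.remove[of _ i]) auto
  also have "\<dots> = (\<Sum>b\<in>Basis. ?c b x * Z x (\<lambda>y. P y (?ev (\<alpha>s[i := dcoord b]) y))) -
      ((\<Sum>b\<in>Basis. ?c b x * P x ((?ev (\<alpha>s[i := dcoord b]) x)[i := ?L (\<alpha>s[i := dcoord b] ! i)])) +
       (\<Sum>j\<in>{..<k} - {i}. \<Sum>b\<in>Basis. ?c b x * P x ((?ev (\<alpha>s[i := dcoord b]) x)[j := ?L (\<alpha>s[i := dcoord b] ! j)])))"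
    unfolding 1 3 using 2 by simp
  also have "\<dots> = (\<Sum>b\<in>Basis. ?c b x * Z x (\<lambda>y. P y (?ev (\<alpha>s[i := dcoord b]) y))) -
      (\<Sum>j<k. \<Sum>b\<in>Basis. ?c b x * P x ((?ev (\<alpha>s[i := dcoord b]) x)[j := ?L (\<alpha>s[i := dcoord b] ! j)]))"
    using i by (subst (2) sum.remove[of _ i]) auto
  also have "\<dots> = (\<Sum>b\<in>Basis. ?c b x * leibniz_defect A Z P (\<alpha>s[i := dcoord b]) x)"
    unfolding leibniz_defect_def
    by (subst sum.swap) (simp add: \<alpha>s(1) right_diff_distrib sum_subtractf sum_distrib_left)
  finally show ?thesis .
qed

text \<open>
  Two lists of forms with equal values at x are compared by replacing one argument at a time by
  coordinate differentials, with m the number of leading arguments in which they may still differ.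
  The coefficients in \<open>leibniz_defect_expand\<close> depend only on the values at x.
\<close>

lemma leibniz_defect_tensorial_aux:
  assumes P: "P \<in> multivector_fields A k" and W: "open W" "x \<in> W" "W \<subseteq> U"
  shows "length \<alpha>s = k \<Longrightarrow> length \<beta>s = k \<Longrightarrow> \<forall>\<alpha>\<in>set \<alpha>s. one_form A W \<alpha> \<Longrightarrow> \<forall>\<alpha>\<in>set \<beta>s. one_form A W \<alpha> \<Longrightarrow> m \<le> k \<Longrightarrow>
    (\<forall>i<k. (\<alpha>s ! i) x = (\<beta>s ! i) x) \<Longrightarrow> (\<forall>i<k. m \<le> i \<longrightarrow> \<alpha>s ! i = \<beta>s ! i) \<Longrightarrow>
    leibniz_defect A Z P \<alpha>s x = leibniz_defect A Z P \<beta>s x"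
proof (induction m arbitrary: \<alpha>s \<beta>s)
  case 0
  then have "\<alpha>s = \<beta>s" by (simp add: nth_equalityI)
  then show ?case by simp
next
  case (Suc m)
  then have m: "m < k" by simp
  have x: "x \<in> U" using W by blast
  have upd: "\<forall>\<alpha>\<in>set (\<gamma>s[m := dcoord b]). one_form A W \<alpha>" if "\<forall>\<alpha>\<in>set \<gamma>s. one_form A W \<alpha>" for \<gamma>s b
    using that one_form_subset[OF one_form_dcoord W(3)] set_update_subset_insert by fastforce
  have "leibniz_defect A Z P (\<alpha>s[m := dcoord b]) x = leibniz_defect A Z P (\<beta>s[m := dcoord b]) x" for b
    by (rule Suc.IH) (use Suc.prems upd in \<open>auto simp: nth_list_update\<close>)
  then show ?case
    using leibniz_defect_expand[OF P Suc.prems(1,3) W(1,2) x m]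
      leibniz_defect_expand[OF P Suc.prems(2,4) W(1,2) x m] Suc.prems(6) m by simp
qed

end

context manifold_with_field
begin

lemma leibniz_defect_tensorial:
  assumes P: "P \<in> multivector_fields A k"
    and \<alpha>s: "length \<alpha>s = k" "\<forall>\<alpha>\<in>set \<alpha>s. one_form A W \<alpha>" "open W" "x \<in> W"
    and \<beta>s: "\<forall>\<alpha>\<in>set \<beta>s. one_form A V \<alpha>" "open V" "x \<in> V"
    and eq: "map (\<lambda>\<alpha>. \<alpha> x) \<alpha>s = map (\<lambda>\<alpha>. \<alpha> x) \<beta>s"
  shows "leibniz_defect A Z P \<alpha>s x = leibniz_defect A Z P \<beta>s x"
proof -
  obtain U \<phi> where U: "(U, \<phi>) \<in> A" "x \<in> U" using chart_at .
  interpret chart_with_field B A Z U \<phi> by unfold_locales (rule U(1))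
  let ?W = "U \<inter> W \<inter> V"
  have l: "length \<beta>s = k" using eq \<alpha>s(1) map_eq_imp_length_eq by metis
  show ?thesis
  proof (rule leibniz_defect_tensorial_aux[OF P, where m = k and W = ?W])
    show "\<forall>i<k. (\<alpha>s ! i) x = (\<beta>s ! i) x" using eq \<alpha>s(1) l by (metis nth_map)
    show "\<forall>\<alpha>\<in>set \<alpha>s. one_form A ?W \<alpha>" "\<forall>\<alpha>\<in>set \<beta>s. one_form A ?W \<alpha>"
      using \<alpha>s(2) \<beta>s(1) one_form_subset[of A _ _ ?W] by blast+
    show "open ?W" using openU \<alpha>s(3) \<beta>s(2) by blast
  qed (use \<alpha>s \<beta>s l U(2) in auto)
qed

lemma lie_multivector_apply:
  assumes P: "P \<in> multivector_fields A k"
    and \<alpha>s: "length \<alpha>s = k" "\<forall>\<alpha>\<in>set \<alpha>s. one_form A W \<alpha>" "open W" "x \<in> W"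
  shows "lie_multivector A Z k P x (map (\<lambda>\<alpha>. \<alpha> x) \<alpha>s) = leibniz_defect A Z P \<alpha>s x"
proof -
  let ?as = "map (\<lambda>\<alpha>. \<alpha> x) \<alpha>s"
  have "set ?as \<subseteq> cotangent_space A x" by (rule one_forms_cotangent[OF \<alpha>s(2,4)])
  moreover have "(THE r. \<forall>W \<beta>s. open W \<and> x \<in> W \<and> (\<forall>\<alpha>\<in>set \<beta>s. one_form A W \<alpha>) \<and> map (\<lambda>\<alpha>. \<alpha> x) \<beta>s = ?as \<longrightarrow>
      r = Z x (\<lambda>y. P y (map (\<lambda>\<alpha>. \<alpha> y) \<beta>s)) - (\<Sum>i<k. P x (?as[i := lie_one_form A Z (\<beta>s ! i) x]))) =
      leibniz_defect A Z P \<alpha>s x" (is "(THE r. ?Q r) = _")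
  proof (rule the_equality)
    show "?Q (leibniz_defect A Z P \<alpha>s x)"
    proof (intro allI impI, elim conjE)
      fix V \<beta>s assume b: "open V" "x \<in> V" "\<forall>\<alpha>\<in>set \<beta>s. one_form A V \<alpha>" "map (\<lambda>\<alpha>. \<alpha> x) \<beta>s = ?as"
      then have "length \<beta>s = k" using \<alpha>s(1) map_eq_imp_length_eq by metis
      with leibniz_defect_tensorial[OF P \<alpha>s b(3,1,2) b(4)[symmetric]]
      show "leibniz_defect A Z P \<alpha>s x = Z x (\<lambda>y. P y (map (\<lambda>\<alpha>. \<alpha> y) \<beta>s)) -
          (\<Sum>i<k. P x (?as[i := lie_one_form A Z (\<beta>s ! i) x]))"
        by (simp add: leibniz_defect_def b(4))
    qed
    fix r assume "?Q r"
    then show "r = leibniz_defect A Z P \<alpha>s x" using \<alpha>s by (simp add: leibniz_defect_def)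
  qed
  ultimately show ?thesis using \<alpha>s(1) by (simp add: lie_multivector_def)
qed

lemma lie_multivector_outside:
  "\<not> (length as = k \<and> set as \<subseteq> cotangent_space A x) \<Longrightarrow> lie_multivector A Z k P x as = 0"
  unfolding lie_multivector_def by (rule if_not_P)

end

context chart_with_field
begin

lemma one_forms_extension_at:
  assumes "set as \<subseteq> cotangent_space A x" "x \<in> U"
  obtains \<alpha>s where "\<forall>\<alpha>\<in>set \<alpha>s. one_form A U \<alpha>" "map (\<lambda>\<alpha>. \<alpha> x) \<alpha>s = as"
proof -
  let ?e = "\<lambda>a y v. \<Sum>b\<in>Basis. a (coord_vector b x) * dcoord b y v"
  have "map (\<lambda>\<alpha>. \<alpha> x) (map ?e as) = as"
    using assms cotangent_expand by (intro nth_equalityI) (auto simp: subset_iff)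
  moreover have "\<forall>\<alpha>\<in>set (map ?e as). one_form A U \<alpha>" using one_form_extension by auto
  ultimately show thesis using that by blast
qed

text \<open>
  Multilinearity of the Lie derivative, in the form in which it is inherited from
  \<open>leibniz_defect_expand\<close> by extending the covectors to one-forms with constant coefficients.
\<close>

lemma lie_multivector_expand:
  assumes P: "P \<in> multivector_fields A k" and as: "length as = k" "set as \<subseteq> cotangent_space A x"
    and x: "x \<in> U" and i: "i < k"
  shows "lie_multivector A Z k P x as =
    (\<Sum>b\<in>Basis. (as ! i) (coord_vector b x) * lie_multivector A Z k P x (as[i := dcoord b x]))"
proof -
  obtain \<alpha>s where \<alpha>s: "\<forall>\<alpha>\<in>set \<alpha>s. one_form A U \<alpha>" "map (\<lambda>\<alpha>. \<alpha> x) \<alpha>s = as"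
    using one_forms_extension_at[OF as(2) x] .
  have l: "length \<alpha>s = k" using \<alpha>s(2) as(1) by auto
  have "lie_multivector A Z k P x (as[i := dcoord b x]) = leibniz_defect A Z P (\<alpha>s[i := dcoord b]) x" for b
  proof -
    have "\<forall>\<alpha>\<in>set (\<alpha>s[i := dcoord b]). one_form A U \<alpha>"
      using \<alpha>s(1) one_form_dcoord set_update_subset_insert by fastforce
    from lie_multivector_apply[OF P _ this openU x] show ?thesis using l \<alpha>s(2) by (simp add: map_update)
  qed
  then show ?thesis
    using lie_multivector_apply[OF P l \<alpha>s(1) openU x] leibniz_defect_expand[OF P l \<alpha>s(1) openU x x i] \<alpha>s(2) l i
    by auto
qed

end

section \<open>Homogeneous functions and brackets\<close>

context manifold_with_field
begin

abbreviation "hom c \<equiv> homogeneous_functions A Z c"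

lemma homD:
  assumes "f \<in> hom c"
  shows "smooth_fun A UNIV f" "f \<in> smooth_near A x" "Z x f = c * f x"
  using assms smooth_fun_imp_near[of UNIV f x] unfolding homogeneous_functions_def by auto

lemma homI:
  "(\<And>x. f \<in> smooth_near A x) \<Longrightarrow> (\<And>x. Z x f = c * f x) \<Longrightarrow> f \<in> hom c"
  unfolding homogeneous_functions_def by (auto intro: smooth_funI)

lemma hom_zero: "(\<lambda>y. 0) \<in> hom c"
  by (rule homI[OF smooth_near_const]) (simp add: tangent_const[OF Z_tangent])

lemma hom_const: "(\<lambda>y. c) \<in> hom 0"
  by (rule homI[OF smooth_near_const]) (simp add: tangent_const[OF Z_tangent])

lemma hom_add: "f \<in> hom c \<Longrightarrow> g \<in> hom c \<Longrightarrow> (\<lambda>y. f y + g y) \<in> hom c"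
  by (rule homI) (auto simp: homD smooth_near_add tangent_add[OF Z_tangent] algebra_simps)

lemma hom_diff: "f \<in> hom c \<Longrightarrow> g \<in> hom c \<Longrightarrow> (\<lambda>y. f y - g y) \<in> hom c"
  by (rule homI) (auto simp: homD smooth_near_diff tangent_diff[OF Z_tangent] algebra_simps)

lemma hom_mult: "f \<in> hom c \<Longrightarrow> g \<in> hom d \<Longrightarrow> (\<lambda>y. f y * g y) \<in> hom (c + d)"
  by (rule homI) (auto simp: homD smooth_near_mult tangent_mult[OF Z_tangent] algebra_simps)

lemma hom_sum: "(\<And>i. i \<in> I \<Longrightarrow> f i \<in> hom c) \<Longrightarrow> (\<lambda>y. \<Sum>i\<in>I. f i y) \<in> hom c"
  by (induction I rule: infinite_finite_induct) (auto intro: hom_zero hom_add)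

lemma bracket_smooth:
  assumes P: "P \<in> multivector_fields A k" and fs: "length fs = k" "\<forall>f\<in>set fs. smooth_fun A UNIV f"
  shows "bracket A P fs \<in> smooth_near A x"
proof -
  have "(\<lambda>y. P y (map (\<lambda>\<alpha>. \<alpha> y) (map (differential A) fs))) \<in> smooth_near A x"
    by (rule multivector_apply_smooth[OF P, where W = UNIV]) (use fs one_form_differential in auto)
  then show ?thesis by (simp add: bracket_def[abs_def] comp_def)
qed

text \<open>
  If f has degree c, the Lie derivative of df is d(Z f) = d(c f) = c df, so each slot contributes its
  degree times the bracket to the sum in the Leibniz rule.
\<close>

lemma lie_multivector_differentials:
  assumes P: "P \<in> multivector_fields A k" and k: "length fs = k"
    and fs: "list_all2 (\<lambda>f d. f \<in> hom d) fs ds"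
  shows "lie_multivector A Z k P x (map (\<lambda>f. differential A f x) fs) =
    Z x (bracket A P fs) - sum_list ds * bracket A P fs x"
proof -
  let ?as = "map (\<lambda>f. differential A f x) fs"
  have hom: "fs ! i \<in> hom (ds ! i)" if "i < k" for i
    using fs that k list_all2_nthD by blast
  have as: "length ?as = k" "set ?as \<subseteq> cotangent_space A x"
    using k differential_cotangent by auto
  have sm: "smooth_fun A UNIV f" if "f \<in> set fs" for f
    using that hom homD(1) k by (metis in_set_conv_nth)
  have "P x (?as[i := lie_one_form A Z (differential A (fs ! i)) x]) = ds ! i * P x ?as" if i: "i < k" for i
  proof -
    have "lie_one_form A Z (differential A (fs ! i)) x = differential A (\<lambda>y. ds ! i * (fs ! i) y) x"
      using lie_one_form_differential[OF homD(1)[OF hom[OF i]]] homD(3)[OF hom[OF i]] by simp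
    also have "\<dots> = cotangent_lc (ds ! i) (?as ! i) 0 (?as ! i)"
    proof
      fix v
      show "differential A (\<lambda>y. ds ! i * (fs ! i) y) x v = cotangent_lc (ds ! i) (?as ! i) 0 (?as ! i) v"
        using tangent_lin[of v x "fs ! i" "fs ! i" "ds ! i" 0] homD(2)[OF hom[OF i]] i k
        by (simp add: differential_def cotangent_lc_def)
    qed
    finally have "P x (?as[i := lie_one_form A Z (differential A (fs ! i)) x]) =
        ds ! i * P x (?as[i := ?as ! i]) + 0 * P x (?as[i := ?as ! i])"
      using alternating_lin[OF multivector_alternating[OF P] as i, of "?as ! i" "?as ! i" "ds ! i" 0]
        as i by (metis nth_mem subsetD)
    then show ?thesis by (simp only: list_update_id mult_zero_left add_0_right)
  qed
  then have "(\<Sum>i<k. P x (?as[i := lie_one_form A Z (differential A (fs ! i)) x])) = sum_list ds * P x ?as"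
    using list_all2_lengthD[OF fs] k by (simp add: sum_list_sum_nth sum_distrib_right atLeast0LessThan)
  moreover have "lie_multivector A Z k P x (map (\<lambda>\<alpha>. \<alpha> x) (map (differential A) fs)) =
      leibniz_defect A Z P (map (differential A) fs) x"
    by (rule lie_multivector_apply[OF P, where W = UNIV]) (use k sm one_form_differential in auto)
  ultimately show ?thesis
    using k by (simp add: leibniz_defect_def bracket_def[abs_def] comp_def)
qed

lemma hom_list_smooth: "list_all2 (\<lambda>f d. f \<in> hom d) fs ds \<Longrightarrow> \<forall>f\<in>set fs. smooth_fun A UNIV f"
  by (metis homD(1) in_set_conv_nth list_all2_nthD)

lemma homogeneous_bracket:
  assumes P: "P \<in> multivector_fields A k" and h: "homogeneous_multivector A Z k n P"
    and fs: "length fs = k" "list_all2 (\<lambda>f d. f \<in> hom d) fs ds"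
  shows "bracket A P fs \<in> hom (n + sum_list ds)"
proof (rule homI)
  fix x
  show "bracket A P fs \<in> smooth_near A x"
    by (rule bracket_smooth[OF P fs(1) hom_list_smooth[OF fs(2)]])
  show "Z x (bracket A P fs) = (n + sum_list ds) * bracket A P fs x"
    using lie_multivector_differentials[OF P fs, of x] h
    unfolding homogeneous_multivector_def by (simp add: bracket_def algebra_simps)
qed

lemma hom_one_list: "set fs \<subseteq> hom 1 \<Longrightarrow> length fs = k \<Longrightarrow> list_all2 (\<lambda>f d. f \<in> hom d) fs (replicate k 1)"
  by (auto simp: list_all2_conv_all_nth subset_iff)

end

context chart_with_field
begin

text \<open>
  The Lie derivative is defined pointwise, so the smoothness of its components is not immediate. It
  follows from the Leibniz rule with L (d\<phi>_b) = d(Z \<phi>_b), all of whose terms are smooth. Its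
  purpose is the passage from a dense set of points to all points.
\<close>

lemma lie_multivector_dcoords_smooth:
  assumes P: "P \<in> multivector_fields A k" and bs: "length bs = k" and x: "x \<in> U"
  shows "(\<lambda>y. lie_multivector A Z k P y (map (\<lambda>b. dcoord b y) bs)) \<in> smooth_near A x"
proof -
  let ?\<alpha>s = "map dcoord bs"
  let ?\<beta>s = "\<lambda>i. ?\<alpha>s[i := differential A (\<lambda>y. Z y (coord (bs ! i)))]"
  have forms: "\<forall>\<alpha>\<in>set ?\<alpha>s. one_form A U \<alpha>" using one_form_dcoord by auto
  have "smooth_fun A U (\<lambda>y. Z y (coord b))" for b
    using openU Z_smooth coord_smooth by (intro smooth_funI) auto
  then have "one_form A U (differential A (\<lambda>y. Z y (coord b)))" for b
    using one_form_differential openU by blast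
  then have forms': "\<forall>\<alpha>\<in>set (?\<beta>s i). one_form A U \<alpha>" for i
    using forms set_update_subset_insert[of ?\<alpha>s i] by blast
  have "(\<lambda>y. Z y (\<lambda>y. P y (map (\<lambda>\<alpha>. \<alpha> y) ?\<alpha>s)) - (\<Sum>i<k. P y (map (\<lambda>\<alpha>. \<alpha> y) (?\<beta>s i)))) \<in> smooth_near A x"
    using bs by (intro smooth_near_diff smooth_near_sum Z_smooth multivector_apply_smooth[OF P _ forms openU x]
        multivector_apply_smooth[OF P _ forms' openU x]) auto
  moreover have "Z y (\<lambda>y. P y (map (\<lambda>\<alpha>. \<alpha> y) ?\<alpha>s)) - (\<Sum>i<k. P y (map (\<lambda>\<alpha>. \<alpha> y) (?\<beta>s i))) =
      lie_multivector A Z k P y (map (\<lambda>b. dcoord b y) bs)" if "y \<in> U" for y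
  proof -
    have "lie_multivector A Z k P y (map (\<lambda>\<alpha>. \<alpha> y) ?\<alpha>s) = leibniz_defect A Z P ?\<alpha>s y"
      by (rule lie_multivector_apply[OF P _ forms openU that]) (simp add: bs)
    then show ?thesis using bs lie_one_form_dcoord[OF that] by (simp add: leibniz_defect_def map_update comp_def)
  qed
  then have "\<forall>\<^sub>F y in nhds x. Z y (\<lambda>y. P y (map (\<lambda>\<alpha>. \<alpha> y) ?\<alpha>s)) - (\<Sum>i<k. P y (map (\<lambda>\<alpha>. \<alpha> y) (?\<beta>s i))) =
      lie_multivector A Z k P y (map (\<lambda>b. dcoord b y) bs)"
    unfolding eventually_nhds using openU x by blast
  ultimately show ?thesis by (rule smooth_near_cong)
qed

text \<open>
  Induction on the number m of leading arguments that are not yet coordinate differentials.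
\<close>

lemma vanishes_if_vanishes_on_dcoords:
  assumes "x \<in> U" and expand: "\<And>as i. length as = k \<Longrightarrow> set as \<subseteq> cotangent_space A x \<Longrightarrow> i < k \<Longrightarrow>
      H as = (\<Sum>b\<in>Basis. (as ! i) (coord_vector b x) * H (as[i := dcoord b x]))"
    and zero: "\<And>bs. length bs = k \<Longrightarrow> set bs \<subseteq> Basis \<Longrightarrow> H (map (\<lambda>b. dcoord b x) bs) = (0::real)"
  shows "length as = k \<Longrightarrow> set as \<subseteq> cotangent_space A x \<Longrightarrow> m \<le> k \<Longrightarrow>
    \<forall>i<k. m \<le> i \<longrightarrow> as ! i \<in> (\<lambda>b. dcoord b x) ` Basis \<Longrightarrow> H as = 0"
proof (induction m arbitrary: as)
  case 0
  then have "as \<in> lists ((\<lambda>b. dcoord b x) ` Basis)" by (auto simp: in_set_conv_nth)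
  then obtain bs where "bs \<in> lists Basis" "as = map (\<lambda>b. dcoord b x) bs"
    unfolding lists_image by blast
  then show ?case using zero 0(1) by auto
next
  case (Suc m)
  have "H (as[m := dcoord b x]) = 0" if "b \<in> Basis" for b
    by (rule Suc.IH) (use Suc.prems that set_update_subset[OF Suc.prems(2) differential_cotangent] in
        \<open>auto simp: nth_list_update\<close>)
  then show ?case using expand[OF Suc.prems(1,2), of m] Suc.prems(3) by simp
qed

end

context manifold_with_field
begin

text \<open>
  On the dense set S the defect H = L P - n P vanishes because all covectors are differentials of
  functions of degree 1. Its components in a chart are continuous, so they vanish everywhere, and
  multilinearity extends this to all covectors.
\<close>

lemma homogeneous_multivectorI:
  assumes P: "P \<in> multivector_fields A k" and S: "open S" "closure S = UNIV"
    and strict: "\<And>x. x \<in> S \<Longrightarrow> cotangent_space A x = {differential A f x | f. f \<in> hom 1}"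
    and br: "\<And>fs. length fs = k \<Longrightarrow> set fs \<subseteq> hom 1 \<Longrightarrow> bracket A P fs \<in> hom (n + real k)"
  shows "homogeneous_multivector A Z k n P"
proof -
  define H where "H x as = lie_multivector A Z k P x as - n * P x as" for x as
  have H_S: "H x as = 0" if x: "x \<in> S" and as: "length as = k" "set as \<subseteq> cotangent_space A x" for x as
  proof -
    have "as \<in> lists ((\<lambda>f. differential A f x) ` hom 1)" using as strict[OF x] by auto
    then obtain fs where fs: "set fs \<subseteq> hom 1" "as = map (\<lambda>f. differential A f x) fs"
      unfolding lists_image by auto
    then have l: "length fs = k" using as by simp
    show ?thesis
      using lie_multivector_differentials[OF P l hom_one_list[OF fs(1) l], of x] homD(3)[OF br[OF l fs(1)], of x]
      by (simp add: H_def fs(2) sum_list_replicate bracket_def algebra_simps)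
  qed
  have "H x as = 0" if as: "length as = k" "set as \<subseteq> cotangent_space A x" for x as
  proof -
    obtain U \<phi> where U: "(U, \<phi>) \<in> A" "x \<in> U" using chart_at .
    interpret chart_with_field B A Z U \<phi> by unfold_locales (rule U(1))
    have zero: "H x (map (\<lambda>b. dcoord b x) bs) = 0" if bs: "length bs = k" "set bs \<subseteq> Basis" for bs
    proof (rule ccontr)
      let ?h = "\<lambda>y. H y (map (\<lambda>b. dcoord b y) bs)"
      assume "?h x \<noteq> 0"
      moreover have "?h \<in> smooth_near A x"
        unfolding H_def by (intro smooth_near_diff smooth_near_mult smooth_near_const
            lie_multivector_dcoords_smooth[OF P bs(1) U(2)] multivector_dcoords_smooth[OF P bs U(2)])
      then have "(?h \<longlongrightarrow> ?h x) (at x)" using smooth_near_isCont isCont_def by blast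
      ultimately have "\<forall>\<^sub>F y in nhds x. ?h y \<noteq> 0"
        using tendsto_imp_eventually_ne eventually_nhds_conv_at by fast
      then obtain V where V: "open V" "x \<in> V" "\<And>y. y \<in> V \<Longrightarrow> ?h y \<noteq> 0"
        unfolding eventually_nhds by blast
      have "x \<in> closure S" using S(2) by simp
      then obtain y where "y \<in> S" "y \<in> V" using V(1,2) closure_iff_nhds_not_empty by blast
      moreover have "?h y = 0" by (rule H_S) (use \<open>y \<in> S\<close> bs differential_cotangent in auto)
      ultimately show False using V(3) by blast
    qed
    have expand: "H x as = (\<Sum>b\<in>Basis. (as ! i) (coord_vector b x) * H x (as[i := dcoord b x]))"
      if "length as = k" "set as \<subseteq> cotangent_space A x" "i < k" for as i
      unfolding H_def lie_multivector_expand[OF P that(1,2) U(2) that(3)]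
        alternating_expand[OF multivector_alternating[OF P] U(2) that]
      by (simp add: sum_subtractf sum_distrib_left right_diff_distrib mult.left_commute)
    show ?thesis
      by (rule vanishes_if_vanishes_on_dcoords[where H = "H x" and m = k, OF U(2) expand zero])
        (use as in auto)
  qed
  moreover have "H x as = 0" if "\<not> (length as = k \<and> set as \<subseteq> cotangent_space A x)" for x as
    using lie_multivector_outside[OF that] alternating_outside[OF multivector_alternating[OF P] that]
    by (simp add: H_def)
  ultimately have "lie_multivector A Z k P x as = n * P x as" for x as
    by (metis H_def eq_iff_diff_eq_0)
  then show ?thesis unfolding homogeneous_multivector_def by blast
qed

end

section \<open>The two components of a jet multivector field\<close>

text \<open>
  Expand the value of F, which is zero, when both slots are filled with the sum of the two entries.
\<close>

lemma alternating_swap: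
  assumes F: "F \<in> alternating_forms k W lc" and ws: "length ws = k" "set ws \<subseteq> W" and ij: "i < j" "j < k"
    and closed: "\<And>a b. a \<in> W \<Longrightarrow> b \<in> W \<Longrightarrow> lc 1 a 1 b \<in> W"
  shows "F (ws[i := ws ! j, j := ws ! i]) = - F ws"
proof -
  let ?a = "ws ! i" let ?b = "ws ! j"
  have ab: "?a \<in> W" "?b \<in> W" using ws ij by auto
  note c = closed[OF ab]
  \<comment> \<open>F as a function of the entries in slots i and j alone.\<close>
  define G where "G p q = F (ws[i := p, j := q])" for p q
  have s: "set (ws[i := p, j := q]) \<subseteq> W" if "p \<in> W" "q \<in> W" for p q
    using ws(2) that by (intro set_update_subset)
  have same: "G p p = 0" if "p \<in> W" for p
    unfolding G_def by (rule alternating_repeated[OF F _ s ij]) (use that ws ij in auto)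
  have right: "G p (lc 1 ?a 1 ?b) = G p ?a + G p ?b" if "p \<in> W" for p
    unfolding G_def
    using alternating_lin[OF F, of "ws[i := p]" j ?a ?b 1 1] ws ij ab set_update_subset[OF ws(2) that] by simp
  have left: "G (lc 1 ?a 1 ?b) q = G ?a q + G ?b q" if "q \<in> W" for q
  proof -
    have swap: "ws[i := p, j := q] = ws[j := q, i := p]" for p
      by (rule list_update_swap) (use ij in simp)
    show ?thesis unfolding G_def swap
      using alternating_lin[OF F, of "ws[j := q]" i ?a ?b 1 1] ws ij ab set_update_subset[OF ws(2) that] by simp
  qed
  have "0 = G ?a ?b + G ?b ?a"
    using same[OF c] right[OF c] left ab same by simp
  moreover have "G ?a ?b = F ws" by (simp add: G_def)
  ultimately show ?thesis by (simp add: G_def)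
qed

text \<open>
  The i-th entry is moved to the front by i transpositions of neighbours.
\<close>

lemma alternating_move_to_front:
  assumes F: "F \<in> alternating_forms k W lc" and closed: "\<And>a b. a \<in> W \<Longrightarrow> b \<in> W \<Longrightarrow> lc 1 a 1 b \<in> W"
  shows "length ws = k \<Longrightarrow> set ws \<subseteq> W \<Longrightarrow> i < k \<Longrightarrow> F ws = (-1) ^ i * F (ws ! i # remove_nth i ws)"
proof (induction i arbitrary: ws)
  case 0
  then show ?case by (cases ws) (auto simp: remove_nth_def)
next
  case (Suc i)
  let ?vs = "ws[i := ws ! Suc i, Suc i := ws ! i]"
  have "remove_nth i ?vs = remove_nth (Suc i) ws"
    using Suc.prems by (intro nth_equalityI) (auto simp: remove_nth_def nth_append nth_list_update min_def less_Suc_eq)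
  moreover have "?vs ! i = ws ! Suc i" using Suc.prems by simp
  moreover have "set ?vs \<subseteq> W" using Suc.prems by (intro set_update_subset) auto
  then have "F ?vs = (-1) ^ i * F (?vs ! i # remove_nth i ?vs)" using Suc by simp
  moreover have "F ?vs = - F ws"
    using alternating_swap[OF F Suc.prems(1,2), of i "Suc i"] closed Suc.prems(3) by simp
  ultimately show ?case by simp
qed

context atlas_manifold
begin

lemma jet_alternating:
  "D \<in> jet_multivector_fields A k \<Longrightarrow> D x \<in> alternating_forms k (cojet_space A x) cojet_lc"
  unfolding jet_multivector_fields_def by blast

lemma jet_smooth:
  "D \<in> jet_multivector_fields A k \<Longrightarrow> (U, \<phi>) \<in> A \<Longrightarrow> length bs = k \<Longrightarrow> set bs \<subseteq> insert None (Some ` Basis) \<Longrightarrow>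
    smooth_fun A U (\<lambda>x. D x (map (jet_coframe A \<phi> x) bs))"
  unfolding jet_multivector_fields_def by blast

lemma multivector_fieldsI:
  assumes "\<And>x as i a b c d. length as = k \<Longrightarrow> set as \<subseteq> cotangent_space A x \<Longrightarrow> i < k \<Longrightarrow>
      a \<in> cotangent_space A x \<Longrightarrow> b \<in> cotangent_space A x \<Longrightarrow>
      P x (as[i := cotangent_lc c a d b]) = c * P x (as[i := a]) + d * P x (as[i := b])"
    and "\<And>x as i j. length as = k \<Longrightarrow> set as \<subseteq> cotangent_space A x \<Longrightarrow> i < j \<Longrightarrow> j < k \<Longrightarrow>
      as ! i = as ! j \<Longrightarrow> P x as = 0"
    and "\<And>x as. \<not> (length as = k \<and> set as \<subseteq> cotangent_space A x) \<Longrightarrow> P x as = 0"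
    and "\<And>U \<phi> bs. (U, \<phi>) \<in> A \<Longrightarrow> length bs = k \<Longrightarrow> set bs \<subseteq> Basis \<Longrightarrow>
      smooth_fun A U (\<lambda>x. P x (map (\<lambda>b. differential A (\<lambda>y. \<phi> y \<bullet> b) x) bs))"
  shows "P \<in> multivector_fields A k"
  unfolding multivector_fields_def alternating_forms_def using assms by blast

lemma cojet_flat: "(a, t) \<in> cojet_space A x \<longleftrightarrow> a \<in> cotangent_space A x"
  by (simp add: cojet_space_def)

lemma cojet_flat_list: "set (map (\<lambda>a. (a, 0)) as) \<subseteq> cojet_space A x \<longleftrightarrow> set as \<subseteq> cotangent_space A x"
  by (auto simp: cojet_space_def)

lemma part0_multivector:
  assumes D: "D \<in> jet_multivector_fields A k"
  shows "part0 D \<in> multivector_fields A k"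
proof (rule multivector_fieldsI)
  fix x and as :: "'m cotangent list" and i and a b :: "'m cotangent" and c d :: real
  assume as: "length as = k" "set as \<subseteq> cotangent_space A x" "i < k"
    and ab: "a \<in> cotangent_space A x" "b \<in> cotangent_space A x"
  show "part0 D x (as[i := cotangent_lc c a d b]) = c * part0 D x (as[i := a]) + d * part0 D x (as[i := b])"
    using alternating_lin[OF jet_alternating[OF D], of "map (\<lambda>a. (a, 0)) as" x i "(a, 0)" "(b, 0)" c d] as ab
    by (simp only: cojet_flat cojet_flat_list) (simp add: part0_def map_update cojet_lc_def)
next
  fix x and as :: "'m cotangent list" and i j
  assume "length as = k" "set as \<subseteq> cotangent_space A x" "i < j" "j < k" "as ! i = as ! j"
  then show "part0 D x as = 0" unfolding part0_def
    by (intro alternating_repeated[OF jet_alternating[OF D], of _ _ i j]) (simp_all only: cojet_flat_list, simp_all)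
next
  fix x and as :: "'m cotangent list"
  assume "\<not> (length as = k \<and> set as \<subseteq> cotangent_space A x)"
  then show "part0 D x as = 0" unfolding part0_def
    by (intro alternating_outside[OF jet_alternating[OF D]]) (simp only: cojet_flat_list length_map, simp)
next
  fix U \<phi> and bs :: "'e list"
  assume c: "(U, \<phi>) \<in> A" "length bs = k" "set bs \<subseteq> Basis"
  then have "smooth_fun A U (\<lambda>x. D x (map (jet_coframe A \<phi> x) (map Some bs)))"
    by (intro jet_smooth[OF D]) auto
  then show "smooth_fun A U (\<lambda>x. part0 D x (map (\<lambda>b. differential A (\<lambda>y. \<phi> y \<bullet> b) x) bs))"
    by (simp add: part0_def jet_coframe_def comp_def)
qed

lemma part1_zero:
  assumes D: "D \<in> jet_multivector_fields A 0"
  shows "part1 D x as = 0"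
  unfolding part1_def by (rule alternating_outside[OF jet_alternating[OF D]]) simp

lemma part1_multivector:
  assumes D: "D \<in> jet_multivector_fields A k"
  shows "part1 D \<in> multivector_fields A (k - 1)"
proof (cases k)
  case 0
  then have "part1 D x as = 0" for x as using part1_zero D by blast
  then show ?thesis
    by (intro multivector_fieldsI) (auto intro!: smooth_funI smooth_near_const chart_props(1))
next
  case (Suc m)
  let ?e = "(\<lambda>v. 0, 1) :: 'm cojet"
  have e: "?e \<in> cojet_space A x" for x by (simp add: cojet_flat cotangent_space_zero)
  show ?thesis unfolding Suc diff_Suc_1
  proof (rule multivector_fieldsI)
    fix x and as :: "'m cotangent list" and i and a b :: "'m cotangent" and c d :: real
    assume as: "length as = m" "set as \<subseteq> cotangent_space A x" "i < m"
      and ab: "a \<in> cotangent_space A x" "b \<in> cotangent_space A x"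
    have "set (?e # map (\<lambda>a. (a, 0)) as) \<subseteq> cojet_space A x"
      using as(2) e cojet_flat_list[of as x] by simp
    then show "part1 D x (as[i := cotangent_lc c a d b]) = c * part1 D x (as[i := a]) + d * part1 D x (as[i := b])"
      using alternating_lin[OF jet_alternating[OF D], of "?e # map (\<lambda>a. (a, 0)) as" x "Suc i" "(a, 0)" "(b, 0)" c d] as ab Suc
      by (simp add: cojet_flat part1_def map_update cojet_lc_def)
  next
    fix x and as :: "'m cotangent list" and i j
    assume as: "length as = m" "set as \<subseteq> cotangent_space A x" "i < j" "j < m" "as ! i = as ! j"
    have "set (?e # map (\<lambda>a. (a, 0)) as) \<subseteq> cojet_space A x"
      using as(2) e cojet_flat_list[of as x] by simp
    then show "part1 D x as = 0" unfolding part1_def using as Suc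
      by (intro alternating_repeated[OF jet_alternating[OF D], of _ _ "Suc i" "Suc j"]) auto
  next
    fix x and as :: "'m cotangent list"
    assume "\<not> (length as = m \<and> set as \<subseteq> cotangent_space A x)"
    then show "part1 D x as = 0" unfolding part1_def
      using cojet_flat_list[of as x] Suc
      by (intro alternating_outside[OF jet_alternating[OF D]]) auto
  next
    fix U \<phi> and bs :: "'e list"
    assume c: "(U, \<phi>) \<in> A" "length bs = m" "set bs \<subseteq> Basis"
    then have "smooth_fun A U (\<lambda>x. D x (map (jet_coframe A \<phi> x) (None # map Some bs)))"
      using Suc by (intro jet_smooth[OF D]) auto
    then show "smooth_fun A U (\<lambda>x. part1 D x (map (\<lambda>b. differential A (\<lambda>y. \<phi> y \<bullet> b) x) bs))"
      by (simp add: part1_def jet_coframe_def comp_def)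
  qed
qed

lemma cojet_slot_split:
  assumes F: "F \<in> alternating_forms k (cojet_space A x) cojet_lc"
    and ws: "length ws = k" "set ws \<subseteq> cojet_space A x" "i < k"
  shows "F ws = F (ws[i := (fst (ws ! i), 0)]) + snd (ws ! i) * F (ws[i := (\<lambda>v. 0, 1)])"
proof -
  have "ws ! i \<in> cojet_space A x" using ws by auto
  then have "fst (ws ! i) \<in> cotangent_space A x" by (metis cojet_flat prod.collapse)
  then have "F (ws[i := cojet_lc 1 (fst (ws ! i), 0) (snd (ws ! i)) (\<lambda>v. 0, 1)]) =
      1 * F (ws[i := (fst (ws ! i), 0)]) + snd (ws ! i) * F (ws[i := (\<lambda>v. 0, 1)])"
    by (intro alternating_lin[OF F ws]) (simp_all add: cojet_flat cotangent_space_zero)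
  moreover have "cojet_lc 1 (fst (ws ! i), 0) (snd (ws ! i)) (\<lambda>v. 0, 1) = ws ! i"
    by (simp add: cojet_lc_def cotangent_lc_def)
  ultimately show ?thesis by simp
qed

text \<open>
  Once the covector e = (0, 1) occupies slot m, the real components of all other entries may be
  changed freely: changing them adds multiples of e, and F vanishes on lists that contain e twice.
  The slots are treated one at a time; p bounds the slots in which the two lists may still differ.
\<close>

lemma cojet_second_components_irrelevant:
  assumes F: "F \<in> alternating_forms k (cojet_space A x) cojet_lc" and m: "m < k"
  shows "length us = k \<Longrightarrow> length vs = k \<Longrightarrow> set us \<subseteq> cojet_space A x \<Longrightarrow> set vs \<subseteq> cojet_space A x \<Longrightarrow>
    us ! m = (\<lambda>v. 0, 1) \<Longrightarrow> vs ! m = (\<lambda>v. 0, 1) \<Longrightarrow> \<forall>i<k. fst (us ! i) = fst (vs ! i) \<Longrightarrow>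
    p \<le> k \<Longrightarrow> \<forall>i<k. p \<le> i \<longrightarrow> us ! i = vs ! i \<Longrightarrow> F us = F vs"
proof (induction p arbitrary: us vs)
  case 0
  then have "us = vs" by (simp add: nth_equalityI)
  then show ?case by simp
next
  case (Suc p)
  let ?e = "(\<lambda>v. 0, 1) :: 'm cojet"
  have p: "p < k" using Suc.prems by simp
  have e: "?e \<in> cojet_space A x" by (simp add: cojet_flat cotangent_space_zero)
  show ?case
  proof (cases "p = m")
    case True
    have "\<forall>i<k. p \<le> i \<longrightarrow> us ! i = vs ! i"
      using Suc.prems True by (metis Suc_leI le_neq_implies_less)
    from Suc.IH[OF Suc.prems(1-7) _ this] show ?thesis using p by simp
  next
    case False
    have flat: "F ws = F (ws[p := (fst (ws ! p), 0)])"
      if ws: "length ws = k" "set ws \<subseteq> cojet_space A x" "ws ! m = ?e" for ws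
    proof -
      have vs: "length (ws[p := ?e]) = k" "set (ws[p := ?e]) \<subseteq> cojet_space A x" "ws[p := ?e] ! p = ws[p := ?e] ! m"
        using ws set_update_subset[OF ws(2) e] p m False by auto
      have "F (ws[p := ?e]) = 0"
        using alternating_repeated[OF F vs(1,2), of p m] alternating_repeated[OF F vs(1,2), of m p] vs(3) False p m
        by (metis nat_neq_iff)
      then show ?thesis using cojet_slot_split[OF F ws(1,2) p] by simp
    qed
    let ?us = "us[p := (fst (us ! p), 0)]" and ?vs = "vs[p := (fst (vs ! p), 0)]"
    have mem: "(fst (ws ! p), 0) \<in> cojet_space A x" if "length ws = k" "set ws \<subseteq> cojet_space A x" for ws
      using that p by (metis cojet_flat nth_mem prod.collapse subsetD)
    have "F ?us = F ?vs"
    proof (rule Suc.IH)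
      show "set ?us \<subseteq> cojet_space A x" "set ?vs \<subseteq> cojet_space A x"
        using Suc.prems(1-4) mem by (intro set_update_subset; simp)+
    qed (use Suc.prems False p in \<open>auto simp: nth_list_update\<close>)
    then show ?thesis using flat Suc.prems by metis
  qed
qed

text \<open>
  Split the entries (a, t) = (a, 0) + t (0, 1) one after another. Each split leaves a term in which
  (0, 1) occupies a slot, and there all other entries may be replaced by their covector part.
\<close>

lemma cojet_expand_aux:
  assumes F: "F \<in> alternating_forms k (cojet_space A x) cojet_lc"
    and ws: "length ws = k" "set ws \<subseteq> cojet_space A x"
  shows "m \<le> k \<Longrightarrow> F ws = F (map (\<lambda>w. (fst w, 0)) (take m ws) @ drop m ws) +
    (\<Sum>i<m. snd (ws ! i) * F ((map (\<lambda>w. (fst w, 0)) ws)[i := (\<lambda>v. 0, 1)]))"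
proof (induction m)
  case 0
  then show ?case by simp
next
  case (Suc m)
  let ?e = "(\<lambda>v. 0, 1) :: 'm cojet"
  let ?flat = "\<lambda>w :: 'm cojet. (fst w, 0 :: real)"
  let ?ws = "\<lambda>m. map ?flat (take m ws) @ drop m ws"
  have m: "m < k" using Suc.prems by simp
  have fl: "?flat w \<in> cojet_space A x" if "w \<in> cojet_space A x" for w
    using that by (metis cojet_flat prod.collapse)
  have e: "?e \<in> cojet_space A x" by (simp add: cojet_flat cotangent_space_zero)
  have lw: "length (?ws m) = k" using ws(1) m by simp
  have nw: "?ws m ! m = ws ! m" using ws(1) m by (simp add: nth_append min_def)
  have sf: "set (map ?flat ws) \<subseteq> cojet_space A x" using ws(2) fl by auto
  have sw: "set (?ws m) \<subseteq> cojet_space A x"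
    using ws(2) fl by (auto dest!: in_set_takeD in_set_dropD)
  have 1: "(?ws m)[m := ?flat (ws ! m)] = ?ws (Suc m)"
    using ws(1) m by (intro nth_equalityI) (auto simp: nth_append nth_list_update min_def less_Suc_eq)
  have "F ((?ws m)[m := ?e]) = F ((map ?flat ws)[m := ?e])"
  proof (rule cojet_second_components_irrelevant[OF F m, where p = k])
    show "set ((?ws m)[m := ?e]) \<subseteq> cojet_space A x" "set ((map ?flat ws)[m := ?e]) \<subseteq> cojet_space A x"
      by (intro set_update_subset sw sf e)+
  qed (use ws(1) m in \<open>auto simp: nth_append nth_list_update min_def\<close>)
  then show ?case
    using Suc cojet_slot_split[OF F lw sw m] unfolding nw 1 by simp
qed

lemma jet_decomposition:
  assumes D: "D \<in> jet_multivector_fields A k"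
  shows "D = join_parts A k (part0 D) (part1 D)"
proof (intro ext)
  fix x ws
  note F = jet_alternating[OF D, of x]
  show "D x ws = join_parts A k (part0 D) (part1 D) x ws"
  proof (cases "length ws = k \<and> set ws \<subseteq> cojet_space A x")
    case False
    then show ?thesis using alternating_outside[OF F] by (auto simp: join_parts_def)
  next
    case True
    let ?e = "(\<lambda>v. 0, 1) :: 'm cojet"
    let ?flat = "\<lambda>w :: 'm cojet. (fst w, 0 :: real)"
    have e: "?e \<in> cojet_space A x" by (simp add: cojet_flat cotangent_space_zero)
    have "set (map ?flat ws) \<subseteq> cojet_space A x"
      using True by (auto simp: cojet_space_def)
    then have s: "set ((map ?flat ws)[i := ?e]) \<subseteq> cojet_space A x" for i
      using e by (intro set_update_subset)
    have closed: "cojet_lc 1 a 1 b \<in> cojet_space A x" if "a \<in> cojet_space A x" "b \<in> cojet_space A x" for a b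
      using that cotangent_space_lin[of "fst a" x "fst b" 1 1] by (auto simp: cojet_space_def cojet_lc_def cotangent_lc_def)
    have "D x ((map ?flat ws)[i := ?e]) = (-1) ^ i * part1 D x (map fst (remove_nth i ws))" if i: "i < k" for i
    proof -
      have "D x ((map ?flat ws)[i := ?e]) =
          (-1) ^ i * D x ((map ?flat ws)[i := ?e] ! i # remove_nth i ((map ?flat ws)[i := ?e]))"
        by (rule alternating_move_to_front[OF F closed]) (use s i True in auto)
      moreover have "remove_nth i ((map ?flat ws)[i := ?e]) = map (\<lambda>a. (a, 0)) (map fst (remove_nth i ws))"
        by (simp add: remove_nth_def take_map drop_map comp_def)
      ultimately show ?thesis using i True by (simp add: part1_def)
    qed
    then show ?thesis
      using cojet_expand_aux[OF F, of ws k] True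
      by (simp add: join_parts_def part0_def comp_def mult.assoc mult.left_commute)
  qed
qed

end

context manifold_with_field
begin

lemma lie_multivector_zero_slot:
  assumes P: "P \<in> multivector_fields A k" and i: "i < k" "as ! i = (\<lambda>v. 0)"
  shows "lie_multivector A Z k P x as = 0"
proof (cases "length as = k \<and> set as \<subseteq> cotangent_space A x")
  case True
  obtain U \<phi> where U: "(U, \<phi>) \<in> A" "x \<in> U" using chart_at .
  interpret chart_with_field B A Z U \<phi> by unfold_locales (rule U(1))
  show ?thesis using lie_multivector_expand[OF P _ _ U(2) i(1), of as] True i(2) by simp
qed (rule lie_multivector_outside)

text \<open>
  The bracket L D^0 + I_M \<and> L D^1 is evaluated on covectors (a, 0) and on lists headed by (0, 1) in
  order to separate the components; conversely D is assembled from its components by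
  \<open>jet_decomposition\<close>. For k = 0 the second component is the zero function.
\<close>

lemma homogeneous_jet_multivector_iff:
  assumes D: "D \<in> jet_multivector_fields A k"
  shows "homogeneous_jet_multivector A Z k n D \<longleftrightarrow>
    homogeneous_multivector A Z k n (part0 D) \<and> homogeneous_multivector A Z (k - 1) n (part1 D)"
    (is "?J \<longleftrightarrow> ?H0 \<and> ?H1")
proof
  note P0 = part0_multivector[OF D] and P1 = part1_multivector[OF D]
  assume ?J
  then have J: "join_parts A k (lie_multivector A Z k (part0 D)) (lie_multivector A Z (k - 1) (part1 D)) x ws = n * D x ws" for x ws
    unfolding homogeneous_jet_multivector_def schouten_jacobi_def by meson
  have "lie_multivector A Z k (part0 D) x as = n * part0 D x as" for x as
  proof (cases "length as = k \<and> set as \<subseteq> cotangent_space A x")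
    case True
    then show ?thesis using J[of x "map (\<lambda>a. (a, 0)) as"] cojet_flat_list[of as x]
      by (simp add: join_parts_def part0_def comp_def)
  next
    case False
    then show ?thesis using lie_multivector_outside[OF False] alternating_outside[OF multivector_alternating[OF P0] False]
      by simp
  qed
  moreover have "lie_multivector A Z (k - 1) (part1 D) x as = n * part1 D x as" for x as
  proof (cases "length as = k - 1 \<and> set as \<subseteq> cotangent_space A x")
    case True
    show ?thesis
    proof (cases k)
      case 0
      have "lie_multivector A Z 0 (part1 D) x (map (\<lambda>\<alpha>. \<alpha> x) []) = leibniz_defect A Z (part1 D) [] x"
        by (rule lie_multivector_apply[where W = UNIV]) (use P1 0 in auto)
      then show ?thesis using True 0 D part1_zero by (simp add: leibniz_defect_def tangent_const[OF Z_tangent])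
    next
      case (Suc m)
      let ?ws = "(\<lambda>v. 0, 1) # map (\<lambda>a. (a, 0)) as :: 'm cojet list"
      have "(\<lambda>v. 0, 1) \<in> cojet_space A x" by (simp add: cojet_flat cotangent_space_zero)
      then have ws: "length ?ws = k \<and> set ?ws \<subseteq> cojet_space A x"
        using True Suc cojet_flat_list[of as x] by auto
      have "lie_multivector A Z k (part0 D) x (map fst ?ws) = 0"
        by (rule lie_multivector_zero_slot[OF P0, of 0]) (use Suc in auto)
      moreover have "(\<Sum>i<k. (-1) ^ i * snd (?ws ! i) * lie_multivector A Z (k - 1) (part1 D) x (map fst (remove_nth i ?ws)))
          = lie_multivector A Z (k - 1) (part1 D) x as"
        unfolding Suc using True Suc
        by (subst sum.lessThan_Suc_shift) (simp add: remove_nth_def comp_def)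
      ultimately show ?thesis using J[of x ?ws] ws by (simp add: join_parts_def part1_def)
    qed
  next
    case False
    then show ?thesis using lie_multivector_outside[OF False] alternating_outside[OF multivector_alternating[OF P1] False]
      by simp
  qed
  ultimately show "?H0 \<and> ?H1" unfolding homogeneous_multivector_def by blast
next
  assume H: "?H0 \<and> ?H1"
  have "join_parts A k (\<lambda>x as. n * part0 D x as) (\<lambda>x as. n * part1 D x as) x ws =
      n * join_parts A k (part0 D) (part1 D) x ws" for x ws
    by (simp add: join_parts_def sum_distrib_left distrib_left mult.left_commute)
  then have "join_parts A k (\<lambda>x as. n * part0 D x as) (\<lambda>x as. n * part1 D x as) =
      (\<lambda>x ws. n * join_parts A k (part0 D) (part1 D) x ws)"
    by (intro ext)
  then show ?J using H jet_decomposition[OF D, symmetric]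
    unfolding homogeneous_jet_multivector_def schouten_jacobi_def homogeneous_multivector_def by simp
qed

lemma sum_list_remove_nth:
  "i < length ds \<Longrightarrow> ds ! i + sum_list (remove_nth i ds) = sum_list (ds :: real list)"
  unfolding remove_nth_def by (subst (5) id_take_nth_drop[of i]) auto

text \<open>
  The i-th term is f_i, of degree d_i, times a bracket of degree n plus the sum of the other degrees.
\<close>

lemma jet_correction_hom:
  assumes D: "D \<in> jet_multivector_fields A k" and h: "homogeneous_multivector A Z (k - 1) n (part1 D)"
    and fs: "length fs = k" "list_all2 (\<lambda>f d. f \<in> hom d) fs ds"
  shows "(\<lambda>x. \<Sum>i<length fs. (-1) ^ i * (fs ! i) x * bracket A (part1 D) (remove_nth i fs) x) \<in> hom (n + sum_list ds)"
proof (rule hom_sum)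
  fix i assume "i \<in> {..<length fs}"
  then have i: "i < k" "i < length ds" using fs list_all2_lengthD[OF fs(2)] by auto
  have "list_all2 (\<lambda>f d. f \<in> hom d) (remove_nth i fs) (remove_nth i ds)"
    unfolding remove_nth_def by (intro list_all2_appendI list_all2_takeI list_all2_dropI fs(2))
  then have "bracket A (part1 D) (remove_nth i fs) \<in> hom (n + sum_list (remove_nth i ds))"
    using fs(1) i(1) by (intro homogeneous_bracket[OF part1_multivector[OF D] h]) (auto simp: remove_nth_def)
  moreover have "fs ! i \<in> hom (ds ! i)" using fs i list_all2_nthD by blast
  ultimately have "(\<lambda>x. (-1) ^ i * ((fs ! i) x * bracket A (part1 D) (remove_nth i fs) x)) \<in>
      hom (0 + (ds ! i + (n + sum_list (remove_nth i ds))))"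
    by (intro hom_mult hom_const)
  then show "(\<lambda>x. (-1) ^ i * (fs ! i) x * bracket A (part1 D) (remove_nth i fs) x) \<in> hom (n + sum_list ds)"
    using sum_list_remove_nth[OF i(2)] by (simp add: mult.assoc add.left_commute)
qed

text \<open>
  Every term in which the differential of the constant function occurs vanishes; what is left is the
  term in which the constant function occurs as a factor.
\<close>

lemma jet_bracket_one:
  assumes D: "D \<in> jet_multivector_fields A (Suc m)" and fs: "length fs = m"
  shows "jet_bracket A D ((\<lambda>y. 1) # fs) = bracket A (part1 D) fs"
proof
  fix x
  note P0 = part0_multivector[OF D] and P1 = part1_multivector[OF D, simplified]
  have "bracket A (part0 D) ((\<lambda>y. 1) # fs) x = 0"
    unfolding bracket_def
    by (rule alternating_zero_slot[OF multivector_alternating[OF P0], of 0]) (simp_all add: differential_const)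
  moreover have "bracket A (part1 D) (remove_nth (Suc i) ((\<lambda>y. 1) # fs)) x = 0" for i
    unfolding bracket_def remove_nth_def
    by (rule alternating_zero_slot[OF multivector_alternating[OF P1], of 0]) (simp_all add: differential_const)
  ultimately show "jet_bracket A D ((\<lambda>y. 1) # fs) x = bracket A (part1 D) fs x"
    unfolding jet_bracket_def by (simp add: sum.lessThan_Suc_shift del: sum.lessThan_Suc) (simp add: remove_nth_def)
qed

end

section \<open>Homogeneity and brackets\<close>

theorem proposition3p6:
  fixes B :: "'e::euclidean_space set"
    and A :: "('m::{t2_space,second_countable_topology}, 'e) atlas"
    and \<Delta> :: "'m \<Rightarrow> 'm tangent"
    and n :: real
    and k :: nat
  assumes "strict_homogeneous_structure B A \<Delta>"
  shows "(\<forall>P\<in>multivector_fields A k.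
            homogeneous_multivector A \<Delta> k n P \<longleftrightarrow>
              (\<forall>fs. length fs = k \<and> set fs \<subseteq> homogeneous_functions A \<Delta> 1 \<longrightarrow>
                 bracket A P fs \<in> homogeneous_functions A \<Delta> (n + real k))) \<and>
         (\<forall>D\<in>jet_multivector_fields A k.
            homogeneous_jet_multivector A \<Delta> k n D \<longleftrightarrow>
              (\<forall>fs ds. length fs = k \<and> length ds = k \<and>
                 (\<forall>i<k. ds ! i \<in> {1, 0} \<and> fs ! i \<in> homogeneous_functions A \<Delta> (ds ! i)) \<longrightarrow>
                 jet_bracket A D fs \<in> homogeneous_functions A \<Delta> (n + sum_list ds)))"
proof -
  interpret manifold_with_field B A \<Delta>
    using assms unfolding strict_homogeneous_structure_def homogeneous_structure_def
    by unfold_locales auto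
  obtain S where S: "open S" "closure S = UNIV"
    "\<And>x. x \<in> S \<Longrightarrow> cotangent_space A x = {differential A f x | f. f \<in> hom 1}"
    using assms unfolding strict_homogeneous_structure_def by blast
  have i: "homogeneous_multivector A \<Delta> k n P \<longleftrightarrow>
      (\<forall>fs. length fs = k \<and> set fs \<subseteq> hom 1 \<longrightarrow> bracket A P fs \<in> hom (n + real k))"
    if P: "P \<in> multivector_fields A k" for P k
  proof (intro iffI allI impI, elim conjE)
    fix fs assume "homogeneous_multivector A \<Delta> k n P" "length fs = k" "set fs \<subseteq> hom 1"
    from homogeneous_bracket[OF P this(1,2) hom_one_list[OF this(3,2)]]
    show "bracket A P fs \<in> hom (n + real k)" by (simp add: sum_list_replicate)
  next
    assume "\<forall>fs. length fs = k \<and> set fs \<subseteq> hom 1 \<longrightarrow> bracket A P fs \<in> hom (n + real k)"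
    then show "homogeneous_multivector A \<Delta> k n P"
      by (intro homogeneous_multivectorI[OF P S]) auto
  qed
  have ii: "homogeneous_jet_multivector A \<Delta> k n D \<longleftrightarrow>
      (\<forall>fs ds. length fs = k \<and> length ds = k \<and> (\<forall>i<k. ds ! i \<in> {1, 0} \<and> fs ! i \<in> hom (ds ! i)) \<longrightarrow>
         jet_bracket A D fs \<in> hom (n + sum_list ds))" (is "_ \<longleftrightarrow> ?R")
    if D: "D \<in> jet_multivector_fields A k" for D
  proof
    note P0 = part0_multivector[OF D] and P1 = part1_multivector[OF D]
    assume "homogeneous_jet_multivector A \<Delta> k n D"
    then have H: "homogeneous_multivector A \<Delta> k n (part0 D)" "homogeneous_multivector A \<Delta> (k - 1) n (part1 D)"
      using homogeneous_jet_multivector_iff[OF D] by blast+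
    show ?R
    proof (intro allI impI, elim conjE)
      fix fs ds assume fs: "length fs = k" and "length ds = k" "\<forall>i<k. ds ! i \<in> {1, 0} \<and> fs ! i \<in> hom (ds ! i)"
      then have "list_all2 (\<lambda>f d. f \<in> hom d) fs ds" by (simp add: list_all2_conv_all_nth)
      from hom_add[OF homogeneous_bracket[OF P0 H(1) fs this] jet_correction_hom[OF D H(2) fs this]]
      show "jet_bracket A D fs \<in> hom (n + sum_list ds)" by (simp add: jet_bracket_def[abs_def])
    qed
  next
    note P0 = part0_multivector[OF D] and P1 = part1_multivector[OF D]
    assume R: ?R
    \<comment> \<open>The second component comes first: its brackets are obtained by inserting the function 1.\<close>
    have H1: "homogeneous_multivector A \<Delta> (k - 1) n (part1 D)"
    proof (cases k)
      case 0
      then have "part1 D = (\<lambda>x as. 0)" using D part1_zero by blast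
      then have "bracket A (part1 D) fs = (\<lambda>y. 0)" for fs by (auto simp: bracket_def)
      then show ?thesis using i[OF P1] hom_zero by simp
    next
      case (Suc m)
      have "bracket A (part1 D) fs \<in> hom (n + real (k - 1))" if fs: "length fs = k - 1" "set fs \<subseteq> hom 1" for fs
      proof -
        have "jet_bracket A D ((\<lambda>y. 1) # fs) \<in> hom (n + sum_list (0 # replicate m 1))"
        proof (rule R[rule_format], intro conjI allI impI)
          fix j assume "j < k"
          then show "(0 # replicate m (1::real)) ! j \<in> {1, 0}"
              "((\<lambda>y. 1) # fs) ! j \<in> hom ((0 # replicate m 1) ! j)"
            using Suc fs hom_const by (auto simp: nth_Cons split: nat.split intro: subsetD[OF fs(2)])
        qed (use Suc fs in auto)
        then show ?thesis using jet_bracket_one[of D m fs] D fs Suc by (simp add: sum_list_replicate)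
      qed
      then show ?thesis using i[OF P1] by blast
    qed
    \<comment> \<open>The terms of the bracket of D that involve the second component are now known to have the
       right degree, and they are subtracted.\<close>
    have "bracket A (part0 D) fs \<in> hom (n + real k)" if fs: "length fs = k" "set fs \<subseteq> hom 1" for fs
    proof -
      note l = hom_one_list[OF fs(2,1)]
      have "jet_bracket A D fs \<in> hom (n + sum_list (replicate k 1))"
        by (rule R[rule_format]) (use fs l in \<open>auto simp: list_all2_conv_all_nth\<close>)
      from hom_diff[OF this jet_correction_hom[OF D H1 fs(1) l]]
      show ?thesis by (simp add: jet_bracket_def[abs_def] sum_list_replicate)
    qed
    then have "homogeneous_multivector A \<Delta> k n (part0 D)" using i[OF P0] by blast
    then show "homogeneous_jet_multivector A \<Delta> k n D" using homogeneous_jet_multivector_iff[OF D] H1 by blast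
  qed
  show ?thesis using i ii by blast
qed

end
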